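(* Let $(p,q)\in(0,1)^2$ with $p+q>1$, let the input sequence $\{x_n\}_{n=1}^N$ be the stationary binary Markov chain with switching probabilities $p,q$ described in the context, let $L:\mathbb{R}^2\to\mathbb{R}$ be the next-token prediction loss (with optimal bias) defined in the context, and let $(\theta_t)_{t\ge0}$ be the corresponding gradient flow trajectory of $L$ starting from $\theta_0$. Then for all initializations $\theta_0\in\mathbb{R}^2$, the gradient flow converges to a critical point of the loss $L$. That is, there exists $\theta_{\lim}\in\mathbb{R}^2$ such that $\lim_{t\to\infty}\theta_t=\theta_{\lim}$ and $\nabla L(\theta_{\lim})=0$. Write $\mathcal{E}_{\mathrm{sad}}=-(1+\log 2)/2$ and $g(w)=\sqrt{w^2-\log(-w)+\mathcal{E}_{\mathrm{sad}}}$ for $w<0$. In particular, $\theta_{\lim}$ is (i) a local minimum if $\theta_0\in\mathcal{I}_{\min}:=\{(e,w): w\in(-1/\sqrt2,0),\ e\in(-g(w),g(w))\}\cup\{(e,w): w\ge0\}$; (ii) a saddle point if $\theta_0\in\mathcal{I}_{\mathrm{sad}}:=\{(e,w): w\in[-1/\sqrt2,0),\ e=\pm g(w)\}$; (iii) a local maximum if $\theta_0\in\mathcal{I}_{\max}:=\{(e,w): e=0,\ w<-1/\sqrt2\}$; (iv) a global minimum if $\theta_0\in\mathcal{I}_\star:=\mathbb{R}^2\setminus(\mathcal{I}_{\min}\cup\mathcal{I}_{\mathrm{sad}}\cup\mathcal{I}_{\max})$. Consequently, when $p+q>1$, if we use the standard initialization $\theta_0\sim\mathcal{N}(0,\sigma^2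 I_2)$ with $\sigma^2\ll 1/\sqrt2$, $\theta_{\lim}$ will be a local minimum with high probability. If $p+q<1$, under the same initialization scheme, $\theta_{\lim}$ will be a global minimum with high probability.
   Context: Data. $(x_n)_{n\ge1}$ is a $\{0,1\}$-valued time-homogeneous first-order Markov chain with $\mathbb{P}(x_{n+1}=1\mid x_n=0)=p$, $\mathbb{P}(x_{n+1}=0\mid x_n=1)=q$, started from its stationary law $\pi=(\pi_0,\pi_1)=(q,p)/(p+q)$; $N\in\mathbb{N}$ is the sequence length. Loss. Let $\ell_{\log}(z)=\log(1+\exp(-z))$. For $\theta=(e,w)\in\mathbb{R}^2$ and $b\in\mathbb{R}$ (here $e$ is a real parameter), $$L(\theta,b)=\frac1N\sum_{n=1}^N\mathbb{E}\Big[\ell_{\log}\Big((2x_{n+1}-1)\big(e^2(1+2w|w|)x_n+b-\tfrac{e^2}{2}\big)\Big)\Big],$$ and $L(\theta)=L(\theta,b_\star(\theta))$ with $b_\star(\theta)=\arg\min_{b\in\mathbb{R}}L(\theta,b)$. Gradient flow. $(\theta_t)_{t\ge0}$, $\theta_t=(e_t,w_t)$, is a $C^1$ curve in $\mathbb{R}^2$ with $\frac{d\theta_t}{dt}=-\nabla L(\theta_t)$ for $t\ge0$ and initial value $\theta_0$. Terminology. $\theta_*$ is a critical point if $\nabla L(\theta_* )=0$. A critical point $\theta_*$ is a local minimum (resp. local maximum) if there is a neighborhood $U$ of $\theta_*$ with $L(\theta_* )\le L(\theta)$ (resp. $L(\theta_* )\ge L(\theta)$) for all $\theta\in U$; if $U$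 is all of $\mathbb{R}^2$ it is a global minimum (resp. maximum). A critical point $\theta_*$ is a saddle point if for all neighborhoods $U$ of $\theta_*$ there are $\theta_1,\theta_2\in U$ such that $L(\theta_1)\le L(\theta_* )\le L(\theta_2)$. *)

theory Defs
  imports "HOL-Probability.Probability"
begin

section \<open>The stationary binary Markov chain\<close>

text \<open>
  The sequence is indexed from 1; \<open>X 0\<close> is irrelevant. \<open>p\<close> is the probability of switching
  from 0 to 1 and \<open>q\<close> that of switching from 1 to 0. In the Markov property, only histories of
  positive probability are conditioned on (\<^const>\<open>cond_prob\<close> is 0 on null events).
\<close>

definition stationary_binary_chain ::
    "'a measure \<Rightarrow> (nat \<Rightarrow> 'a \<Rightarrow> nat) \<Rightarrow> real \<Rightarrow> real \<Rightarrow> bool" where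
  "stationary_binary_chain M X p q \<longleftrightarrow>
     prob_space M \<and>
     (\<forall>n\<ge>1. X n \<in> measurable M (count_space {0, 1})) \<and>
     (\<forall>n\<ge>1. \<forall>a y. \<P>(\<omega> in M. \<forall>i\<in>{1..n}. X i \<omega> = a i) > 0 \<longrightarrow>
        \<P>(\<omega> in M. X (Suc n) \<omega> = y \<bar> \<forall>i\<in>{1..n}. X i \<omega> = a i)
          = \<P>(\<omega> in M. X (Suc n) \<omega> = y \<bar> X n \<omega> = a n)) \<and>
     (\<forall>n\<ge>1. \<P>(\<omega> in M. X (Suc n) \<omega> = 1 \<bar> X n \<omega> = 0) = p) \<and>
     (\<forall>n\<ge>1. \<P>(\<omega> in M. X (Suc n) \<omega> = 0 \<bar> X n \<omega> = 1) = q) \<and>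
     \<P>(\<omega> in M. X 1 \<omega> = 0) = q / (p + q) \<and>
     \<P>(\<omega> in M. X 1 \<omega> = 1) = p / (p + q)"


section \<open>The next-token prediction loss\<close>

definition log_loss :: "real \<Rightarrow> real" where
  "log_loss z = ln (1 + exp (- z))"

definition loss_bias ::
    "'a measure \<Rightarrow> (nat \<Rightarrow> 'a \<Rightarrow> nat) \<Rightarrow> nat \<Rightarrow> real \<times> real \<Rightarrow> real \<Rightarrow> real" where
  "loss_bias M X N = (\<lambda>(e, w) b.
     1 / real N * (\<Sum>n = 1..N. \<integral>\<omega>.
       log_loss ((2 * real (X (n + 1) \<omega>) - 1) *
         (e\<^sup>2 * (1 + 2 * w * \<bar>w\<bar>) * real (X n \<omega>) + b - e\<^sup>2 / 2)) \<partial>M))"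

definition best_bias ::
    "'a measure \<Rightarrow> (nat \<Rightarrow> 'a \<Rightarrow> nat) \<Rightarrow> nat \<Rightarrow> real \<times> real \<Rightarrow> real" where
  "best_bias M X N \<theta> = arg_min (loss_bias M X N \<theta>) (\<lambda>_. True)"

definition loss ::
    "'a measure \<Rightarrow> (nat \<Rightarrow> 'a \<Rightarrow> nat) \<Rightarrow> nat \<Rightarrow> real \<times> real \<Rightarrow> real" where
  "loss M X N \<theta> = loss_bias M X N \<theta> (best_bias M X N \<theta>)"


section \<open>Critical points and gradient flow\<close>

text \<open>\<^term>\<open>GDERIV L \<theta> :> D\<close> says that \<open>L\<close> is differentiable at \<open>\<theta>\<close> with gradient \<open>D\<close>.\<close>

definition critical_point :: "('a::real_inner \<Rightarrow> real) \<Rightarrow> 'a \<Rightarrow> bool" where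
  "critical_point L x \<longleftrightarrow> (GDERIV L x :> 0)"

definition local_minimum :: "('a::real_inner \<Rightarrow> real) \<Rightarrow> 'a \<Rightarrow> bool" where
  "local_minimum L x \<longleftrightarrow>
     critical_point L x \<and> (\<exists>U. open U \<and> x \<in> U \<and> (\<forall>y\<in>U. L x \<le> L y))"

definition local_maximum :: "('a::real_inner \<Rightarrow> real) \<Rightarrow> 'a \<Rightarrow> bool" where
  "local_maximum L x \<longleftrightarrow>
     critical_point L x \<and> (\<exists>U. open U \<and> x \<in> U \<and> (\<forall>y\<in>U. L x \<ge> L y))"

definition global_minimum :: "('a::real_inner \<Rightarrow> real) \<Rightarrow> 'a \<Rightarrow> bool" where
  "global_minimum L x \<longleftrightarrow> critical_point L x \<and> (\<forall>y. L x \<le> L y)"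

text \<open>The two inequalities are non-strict, as in the source.\<close>

definition saddle_point :: "('a::real_inner \<Rightarrow> real) \<Rightarrow> 'a \<Rightarrow> bool" where
  "saddle_point L x \<longleftrightarrow>
     critical_point L x \<and>
     (\<forall>U. open U \<and> x \<in> U \<longrightarrow> (\<exists>y\<in>U. \<exists>z\<in>U. L y \<le> L x \<and> L x \<le> L z))"

text \<open>\<open>\<theta>\<close> is a continuously differentiable curve on \<open>[0, \<infinity>)\<close> with \<open>\<theta>' = - \<nabla>L(\<theta>)\<close>.\<close>

definition gradient_flow :: "('a::real_inner \<Rightarrow> real) \<Rightarrow> (real \<Rightarrow> 'a) \<Rightarrow> bool" where
  "gradient_flow L \<theta> \<longleftrightarrow>
     (\<exists>\<theta>'. continuous_on {0..} \<theta>' \<and>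
        (\<forall>t\<ge>0. (\<theta> has_vector_derivative \<theta>' t) (at t within {0..}) \<and>
               (GDERIV L (\<theta> t) :> - \<theta>' t)))"


section \<open>The initialization regions\<close>

definition E_sad :: real where
  "E_sad = - (1 + ln 2) / 2"

definition g :: "real \<Rightarrow> real" where
  "g w = sqrt (w\<^sup>2 - ln (- w) + E_sad)"

definition I_min :: "(real \<times> real) set" where
  "I_min = {(e, w). - 1 / sqrt 2 < w \<and> w < 0 \<and> - g w < e \<and> e < g w} \<union> {(e, w). w \<ge> 0}"

definition I_sad :: "(real \<times> real) set" where
  "I_sad = {(e, w). - 1 / sqrt 2 \<le> w \<and> w < 0 \<and> (e = g w \<or> e = - g w)}"

definition I_max :: "(real \<times> real) set" where
  "I_max = {(e, w). e = 0 \<and> w < - 1 / sqrt 2}"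

definition I_star :: "(real \<times> real) set" where
  "I_star = UNIV - (I_min \<union> I_sad \<union> I_max)"


section \<open>Random initialization\<close>

text \<open>The law \<open>N(0, \<sigma>\<^sup>2 I\<^sub>2)\<close>: two independent centred normals with standard deviation \<open>\<sigma>\<close>.\<close>

definition gaussian_init :: "real \<Rightarrow> (real \<times> real) measure" where
  "gaussian_init \<sigma> =
     density lborel (normal_density 0 \<sigma>) \<Otimes>\<^sub>M density lborel (normal_density 0 \<sigma>)"

text \<open>
  \<open>P\<close> holds on a measurable event of probability at least \<open>c\<close>; this way
  measurability of \<open>P\<close> itself need not be presupposed.
\<close>

definition holds_with_prob_ge :: "'a measure \<Rightarrow> real \<Rightarrow> ('a \<Rightarrow> bool) \<Rightarrow> bool" where
  "holds_with_prob_ge M c P \<longleftrightarrow> (\<exists>A\<in>sets M. measure M A \<ge> c \<and> (\<forall>x\<in>A. P x))"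

definition flow_limit_satisfies ::
    "('a::real_inner \<Rightarrow> real) \<Rightarrow> 'a \<Rightarrow> ('a \<Rightarrow> bool) \<Rightarrow> bool" where
  "flow_limit_satisfies L \<theta>\<^sub>0 P \<longleftrightarrow>
     (\<forall>\<theta>. gradient_flow L \<theta> \<and> \<theta> 0 = \<theta>\<^sub>0 \<longrightarrow> (\<exists>\<theta>lim. (\<theta> \<longlongrightarrow> \<theta>lim) at_top \<and> P \<theta>lim))"

end

theory Submission
  imports Defs "HOL-Real_Asymp.Real_Asymp"
begin

text \<open>
  By stationarity the loss depends on \<open>(e, w)\<close> only through \<open>x = e\<^sup>2 (1 + 2 w \<bar>w\<bar>)\<close>, the difference of
  the logits after the symbols 1 and 0: it is \<open>\<phi>(x)\<close>, where \<open>\<phi>\<close> strictly decreases up to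
  \<open>a = ln ((1 - p) (1 - q) / (p q))\<close> and strictly increases afterwards. As the loss decreases along the flow,
  \<open>x - a\<close> never changes sign, so \<open>w\<close> is monotone; for \<open>w < 0\<close> the quantity \<open>e\<^sup>2 - w\<^sup>2 + ln (- w)\<close>
  is conserved, and otherwise \<open>e\<^sup>2\<close> is monotone too. Hence bounded trajectories converge, and the limit
  is critical, that is \<open>e = 0\<close> or \<open>x = a\<close>. Which of the two occurs is decided by comparing the conserved
  quantity with its value at the saddle \<open>(0, - 1 / sqrt 2)\<close>. With non-strict inequalities, every
  critical point is a saddle point.
\<close>

section \<open>Functions on a half-line\<close>

text \<open>On the axis \<open>e = 0\<close> the conserved quantity is
  \<open>- w\<^sup>2 + ln (- w)\<close>, whose maximum over \<open>w < 0\<close>, attained at the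
  saddle, is \<open>E_sad\<close>. This explains the regions: \<open>e = g w\<close> and
  \<open>e = - g w\<close> form the level set through the saddle. A trajectory above that level
  cannot end on the axis, and one below it cannot cross \<open>w = - 1 / sqrt 2\<close>. Boundedness
  is delicate when \<open>a < 0\<close>, \<open>w < 0\<close> and \<open>x\<close> stays above
  \<open>a\<close>: there \<open>w\<close> decreases and \<open>e\<^sup>2\<close> may grow. On a
  level set of the conserved quantity, however, \<open>x\<close> is a function of \<open>w\<close>
  alone that tends to minus infinity with \<open>w\<close>, so \<open>x \<ge> a\<close> bounds
  \<open>w\<close> from below. Signs of \<open>e\<close> and \<open>w\<close> are controlled by
  linear equations whose coefficients are known along the trajectory; this also keeps the logarithm
  defined for all times.\<close>

lemma halfline_deriv_at:
  assumes "(f has_real_derivative d) (at t within {0..})" "t > 0"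
  shows "(f has_real_derivative d) (at t)"
  using assms at_within_interior[of t "{0..}"] by simp

lemma halfline_continuous_on:
  assumes "\<And>t. t \<ge> 0 \<Longrightarrow> (f has_real_derivative f' t) (at t within {0..})"
  shows "continuous_on {0::real..} f"
  using assms by (auto simp: continuous_on_eq_continuous_within intro: DERIV_continuous)

lemma halfline_nondecreasing:
  assumes d: "\<And>t. t \<ge> 0 \<Longrightarrow> (f has_real_derivative f' t) (at t within {0..})"
    and pos: "\<And>t. t \<ge> r \<Longrightarrow> f' t \<ge> 0" and st: "0 \<le> r" "r \<le> s" "s \<le> t"
  shows "f s \<le> f t"
proof (rule DERIV_nonneg_imp_increasing_open[OF \<open>s \<le> t\<close>])
  show "continuous_on {s..t} f"
    by (rule continuous_on_subset[OF halfline_continuous_on[of f f', OF d]]) (use st in auto)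
  fix x assume "s < x" "x < t"
  then show "\<exists>y. DERIV f x :> y \<and> y \<ge> 0"
    using halfline_deriv_at[OF d, of x] pos[of x] st by auto
qed

lemma halfline_nonincreasing:
  assumes d: "\<And>t. t \<ge> 0 \<Longrightarrow> (f has_real_derivative f' t) (at t within {0..})"
    and neg: "\<And>t. t \<ge> r \<Longrightarrow> f' t \<le> 0" and st: "0 \<le> r" "r \<le> s" "s \<le> t"
  shows "f t \<le> f s"
proof -
  have "((\<lambda>t. - f t) has_real_derivative - f' t) (at t within {0..})" if "t \<ge> 0" for t
    using that by (intro DERIV_minus d)
  from halfline_nondecreasing[OF this, of r s t] neg st show ?thesis by simp
qed

lemma halfline_constant:
  assumes d: "\<And>t. t \<ge> 0 \<Longrightarrow> (f has_real_derivative 0) (at t within {0..})" and "t \<ge> 0"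
  shows "f t = f 0"
proof (rule antisym)
  show "f t \<le> f 0" by (rule halfline_nonincreasing[of f "\<lambda>_. 0" 0, OF d]) (use assms(2) in auto)
  show "f 0 \<le> f t" by (rule halfline_nondecreasing[of f "\<lambda>_. 0" 0, OF d]) (use assms(2) in auto)
qed

lemma nondecreasing_bounded_converges:
  fixes f :: "real \<Rightarrow> real"
  assumes mono: "\<And>s t. r \<le> s \<Longrightarrow> s \<le> t \<Longrightarrow> f s \<le> f t" and bd: "\<And>t. t \<ge> r \<Longrightarrow> f t \<le> B"
  shows "\<exists>l. (f \<longlongrightarrow> l) at_top"
proof
  have bdd: "bdd_above (f ` {r..})" using bd by (auto simp: bdd_above_def)
  show "(f \<longlongrightarrow> (SUP t\<in>{r..}. f t)) at_top"
  proof (rule increasing_tendsto)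
    show "\<forall>\<^sub>F t in at_top. f t \<le> (SUP t\<in>{r..}. f t)"
      using eventually_ge_at_top[of r] by eventually_elim (intro cSUP_upper bdd, simp)
    fix x assume "x < (SUP t\<in>{r..}. f t)"
    then obtain s where "s \<ge> r" "x < f s" by (subst (asm) less_cSUP_iff[OF _ bdd]) auto
    then show "\<forall>\<^sub>F t in at_top. x < f t"
      using mono[of s] by (intro eventually_mono[OF eventually_ge_at_top[of s]]) fastforce
  qed
qed

lemma nonincreasing_bounded_converges:
  fixes f :: "real \<Rightarrow> real"
  assumes mono: "\<And>s t. r \<le> s \<Longrightarrow> s \<le> t \<Longrightarrow> f t \<le> f s" and bd: "\<And>t. t \<ge> r \<Longrightarrow> B \<le> f t"
  shows "\<exists>l. (f \<longlongrightarrow> l) at_top"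
proof -
  obtain l where "((\<lambda>t. - f t) \<longlongrightarrow> l) at_top"
    using nondecreasing_bounded_converges[of r "\<lambda>t. - f t" "- B"] mono bd by auto
  then show ?thesis using tendsto_minus by fastforce
qed

text \<open>By l'Hospital \<open>f x / x\<close> tends to \<open>m\<close>, while convergence of
  \<open>f\<close> makes it tend to 0. This is what makes limits of trajectories critical.\<close>

lemma convergent_derivative_limit_zero:
  assumes d: "\<And>t. t \<ge> 0 \<Longrightarrow> (f has_real_derivative f' t) (at t within {0..})"
    and lim: "(f \<longlongrightarrow> l) at_top" and lim': "(f' \<longlongrightarrow> m) at_top"
  shows "m = 0"
proof -
  have "((\<lambda>x. f x / x) \<longlongrightarrow> m) at_top"
  proof (rule lhospital_at_top_at_top[where f' = f' and g' = "\<lambda>_. 1"])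
    show "\<forall>\<^sub>F x in at_top. DERIV f x :> f' x"
      using eventually_gt_at_top[of 0] by eventually_elim (rule halfline_deriv_at[OF d], auto)
  qed (use lim' in \<open>auto intro: filterlim_ident\<close>)
  moreover have "((\<lambda>x. f x / x) \<longlongrightarrow> 0) at_top"
    by (rule tendsto_divide_0[OF lim filterlim_at_top_imp_at_infinity]) (rule filterlim_ident)
  ultimately show ?thesis by (rule tendsto_unique[rotated]) simp
qed

text \<open>Integrating factor. It serves to control signs: \<open>y t\<close> is \<open>y 0\<close>
  times a positive number, so \<open>y\<close> never changes sign and a zero stays a zero.\<close>

lemma linear_ode_solution:
  assumes d: "\<And>t. t \<ge> 0 \<Longrightarrow> (y has_real_derivative c t * y t) (at t within {0..})"
    and c: "continuous_on {0..} c" and "t \<ge> 0"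
  shows "y t = y 0 * exp (integral {0..t} c)"
proof -
  have dC: "((\<lambda>t. integral {0..t} c) has_real_derivative c t) (at t within {0..})" if "t \<ge> 0" for t
  proof -
    \<comment> \<open>The right end \<open>t + 1\<close> keeps \<open>t\<close> off the right
      boundary, so the compact interval and the half-line give the same filter at
      \<open>t\<close>.\<close>
    have "((\<lambda>t. integral {0..t} c) has_real_derivative c t) (at t within {0..t+1})"
      by (rule integral_has_real_derivative) (use that in \<open>auto intro: continuous_on_subset[OF c]\<close>)
    moreover have "at t within {0..} = at t within {0..t+1}"
      by (rule at_within_nhd[of t "{..<t+1}"]) (use that in auto)
    ultimately show ?thesis by simp
  qed
  define z where "z t = y t * exp (- integral {0..t} c)" for t
  have dz: "(z has_real_derivative 0) (at t within {0..})" if "t \<ge> 0" for t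
  proof -
    have "(z has_real_derivative c t * y t * exp (- integral {0..t} c)
        + exp (- integral {0..t} c) * (- c t) * y t) (at t within {0..})"
      unfolding z_def by (rule DERIV_mult[OF d[OF that] DERIV_chain2[OF DERIV_exp DERIV_minus[OF dC[OF that]]]])
    then show ?thesis by (simp add: mult.commute mult.left_commute)
  qed
  have "y t * exp (- integral {0..t} c) = y 0"
    using halfline_constant[OF dz \<open>t \<ge> 0\<close>] by (simp add: z_def)
  then show ?thesis by (metis exp_minus_inverse mult.assoc mult.commute mult.right_neutral)
qed

text \<open>At 0 the difference quotient is \<open>\<bar>h\<bar>\<close>, which tends to 0; hence
  the loss is differentiable across \<open>w = 0\<close>.\<close>

lemma has_real_derivative_mult_abs:
  "((\<lambda>w. w * \<bar>w\<bar>) has_real_derivative 2 * \<bar>w\<bar>) (at (w::real) within S)"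
proof (rule has_field_derivative_at_within)
  consider "w > 0" | "w < 0" | "w = 0" by linarith
  then show "((\<lambda>w. w * \<bar>w\<bar>) has_real_derivative 2 * \<bar>w\<bar>) (at w)"
  proof cases
    case 1
    have "((\<lambda>w. w * w) has_real_derivative 2 * \<bar>w\<bar>) (at w)"
      using 1 by (auto intro!: derivative_eq_intros)
    then show ?thesis
      by (rule has_field_derivative_transform_within_open[where S="{0<..}"]) (use 1 in auto)
  next
    case 2
    have "((\<lambda>w. - (w * w)) has_real_derivative 2 * \<bar>w\<bar>) (at w)"
      using 2 by (auto intro!: derivative_eq_intros)
    then show ?thesis
      by (rule has_field_derivative_transform_within_open[where S="{..<0}"]) (use 2 in auto)
  next
    case 3
    have "((\<lambda>h::real. \<bar>h\<bar>) \<longlongrightarrow> 0) (at 0)" by (rule tendsto_eq_intros) (auto intro: tendsto_rabs)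
    then have "((\<lambda>h::real. h * \<bar>h\<bar> / h) \<longlongrightarrow> 0) (at 0)"
      by (rule Lim_transform_eventually) (auto simp: eventually_at_filter)
    with 3 show ?thesis by (simp add: DERIV_def)
  qed
qed

section \<open>The parametrized potential\<close>

definition gain :: "real \<Rightarrow> real" where
  "gain w = 1 + 2 * w * \<bar>w\<bar>"

definition logit_jump :: "real \<times> real \<Rightarrow> real" where
  "logit_jump = (\<lambda>(e, w). e\<^sup>2 * gain w)"

lemma gain_deriv: "(gain has_real_derivative 4 * \<bar>w\<bar>) (at w within S)"
proof -
  have "((\<lambda>w. 1 + 2 * (w * \<bar>w\<bar>)) has_real_derivative 0 + 2 * (2 * \<bar>w\<bar>)) (at w within S)"
    by (intro DERIV_add DERIV_const DERIV_cmult has_real_derivative_mult_abs)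
  then show ?thesis by (simp add: gain_def[abs_def] mult.assoc)
qed

lemma continuous_on_gain [continuous_intros]:
  "continuous_on S f \<Longrightarrow> continuous_on S (\<lambda>x. gain (f x))"
  unfolding gain_def by (intro continuous_intros)

lemma tendsto_gain [tendsto_intros]: "(f \<longlongrightarrow> l) F \<Longrightarrow> ((\<lambda>x. gain (f x)) \<longlongrightarrow> gain l) F"
  unfolding gain_def by (intro tendsto_intros)

lemma gain_mono: "v \<le> w \<Longrightarrow> gain v \<le> gain w"
  by (rule DERIV_nonneg_imp_nondecreasing) (auto intro!: exI gain_deriv)

lemma gain_nonneg: "w \<ge> 0 \<Longrightarrow> gain w \<ge> 1"
  by (simp add: gain_def)

lemma gain_neg_arg: "w < 0 \<Longrightarrow> gain w = 1 - 2 * w\<^sup>2"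
  by (simp add: gain_def power2_eq_square)

lemma gain_zero: "gain (- (1 / sqrt 2)) = 0"
  by (simp add: gain_neg_arg power_divide)

lemma gain_pos_iff: "gain w > 0 \<longleftrightarrow> - (1 / sqrt 2) < w"
proof
  assume "gain w > 0" then show "- (1 / sqrt 2) < w"
    using gain_mono[of w "- (1 / sqrt 2)"] gain_zero by linarith
next
  assume w: "- (1 / sqrt 2) < w"
  show "gain w > 0"
  proof (cases "w < 0")
    case True
    with w have "(- w)\<^sup>2 < (1 / sqrt 2)\<^sup>2" by (intro power_strict_mono) auto
    then show ?thesis using True by (simp add: gain_neg_arg power_divide)
  qed (use gain_nonneg[of w] in linarith)
qed

lemma gain_neg_iff: "gain w < 0 \<longleftrightarrow> w < - (1 / sqrt 2)"
proof
  assume "gain w < 0" then show "w < - (1 / sqrt 2)"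
    using gain_mono[of "- (1 / sqrt 2)" w] gain_zero by linarith
next
  assume w: "w < - (1 / sqrt 2)"
  have "(1 / sqrt 2)\<^sup>2 < (- w)\<^sup>2" using w by (intro power_strict_mono) auto
  moreover have "w < 0" using w by (rule less_trans) simp
  ultimately show "gain w < 0" by (simp add: gain_neg_arg power_divide)
qed

text \<open>The dynamics see the loss only through the position \<open>a\<close> of its single
  minimum and the sign of \<open>\<phi>'\<close> on either side. The formulas of the chain enter
  later, when \<open>switching_probs\<close> is shown to be an instance.\<close>

locale potential =
  fixes \<phi> \<phi>' :: "real \<Rightarrow> real" and a :: real
  assumes \<phi>_deriv: "(\<phi> has_real_derivative \<phi>' x) (at x)"
    and \<phi>'_cont: "continuous_on UNIV \<phi>'"
    and \<phi>'_pos: "a < x \<Longrightarrow> \<phi>' x > 0"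
    and \<phi>'_neg: "x < a \<Longrightarrow> \<phi>' x < 0"
begin

definition L :: "real \<times> real \<Rightarrow> real" where
  "L \<theta> = \<phi> (logit_jump \<theta>)"

lemma \<phi>_cont: "continuous_on S \<phi>"
  using \<phi>_deriv by (auto intro!: continuous_at_imp_continuous_on DERIV_isCont)

lemma \<phi>_increasing: "a \<le> x \<Longrightarrow> x < y \<Longrightarrow> \<phi> x < \<phi> y"
  by (rule DERIV_pos_imp_increasing_open) (use \<phi>_deriv \<phi>'_pos \<phi>_cont in force)+

lemma \<phi>_decreasing: "y \<le> a \<Longrightarrow> x < y \<Longrightarrow> \<phi> y < \<phi> x"
  by (rule DERIV_neg_imp_decreasing_open) (use \<phi>_deriv \<phi>'_neg \<phi>_cont in force)+

lemma \<phi>_min: "x \<noteq> a \<Longrightarrow> \<phi> a < \<phi> x"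
  using \<phi>_increasing[of a x] \<phi>_decreasing[of a x] by linarith

lemma \<phi>_min_le: "\<phi> a \<le> \<phi> x"
  using \<phi>_min[of x] by (cases "x = a") auto

lemma \<phi>'_min: "\<phi>' a = 0"
  by (rule DERIV_local_min[OF \<phi>_deriv, of 1]) (auto intro: \<phi>_min_le)

lemma \<phi>'_eq_0_iff: "\<phi>' x = 0 \<longleftrightarrow> x = a"
  using \<phi>'_min \<phi>'_pos[of x] \<phi>'_neg[of x] by fastforce

lemma \<phi>'_nonneg: "a \<le> x \<Longrightarrow> \<phi>' x \<ge> 0"
  using \<phi>'_pos[of x] \<phi>'_min by (cases "x = a") auto

lemma \<phi>'_nonpos: "x \<le> a \<Longrightarrow> \<phi>' x \<le> 0"
  using \<phi>'_neg[of x] \<phi>'_min by (cases "x = a") auto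

lemma tendsto_\<phi>': "(f \<longlongrightarrow> l) F \<Longrightarrow> ((\<lambda>x. \<phi>' (f x)) \<longlongrightarrow> \<phi>' l) F"
  using \<phi>'_cont by (auto intro: continuous_on_tendsto_compose)

lemma gradient:
  "GDERIV L (e, w) :> (\<phi>' (e\<^sup>2 * gain w) * (2 * e * gain w), \<phi>' (e\<^sup>2 * gain w) * (4 * e\<^sup>2 * \<bar>w\<bar>))"
proof -
  have "((\<lambda>\<theta>. gain (snd \<theta>)) has_derivative (\<lambda>h. snd h * (4 * \<bar>snd (e, w)\<bar>))) (at (e, w))"
    by (rule DERIV_compose_FDERIV[OF gain_deriv has_derivative_snd[OF has_derivative_ident]])
  moreover have "((\<lambda>\<theta>. (fst \<theta>)\<^sup>2) has_derivative (\<lambda>h. 2 * e * fst h)) (at (e, w))"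
    by (auto intro!: derivative_eq_intros simp: mult_ac)
  ultimately have "(logit_jump has_derivative
      (\<lambda>h. e\<^sup>2 * (snd h * (4 * \<bar>w\<bar>)) + (2 * e * fst h) * gain w)) (at (e, w))"
    unfolding logit_jump_def case_prod_beta by (rule has_derivative_mult[rotated, THEN has_derivative_eq_rhs]) auto
  from DERIV_compose_FDERIV[OF \<phi>_deriv this]
  show ?thesis
    unfolding gderiv_def L_def
    by (rule has_derivative_eq_rhs) (auto simp: logit_jump_def inner_prod_def algebra_simps)
qed

section \<open>Critical points and their types\<close>

lemma critical_pointI: "e = 0 \<or> logit_jump (e, w) = a \<Longrightarrow> critical_point L (e, w)"
  unfolding critical_point_def using gradient[of e w] \<phi>'_min
  by (auto simp: logit_jump_def zero_prod_def)

lemma global_minimumI: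
  assumes "logit_jump (e, w) = a"
  shows "global_minimum L (e, w)"
  using critical_pointI[of e w] assms \<phi>_min_le by (simp add: global_minimum_def L_def)

text \<open>Since \<open>a < 0\<close>, the value 0 lies on the increasing side of
  \<open>\<phi>\<close>; where \<open>gain\<close> is positive, \<open>logit_jump\<close> is
  nonnegative, so nothing there falls below \<open>\<phi> 0\<close>.\<close>

lemma local_minimum_axis:
  assumes "a < 0" and w: "- (1 / sqrt 2) < w"
  shows "local_minimum L (0, w)"
  unfolding local_minimum_def
proof (intro conjI exI ballI)
  show "critical_point L (0, w)" by (rule critical_pointI) simp
  show "open ((UNIV::real set) \<times> {- (1 / sqrt 2)<..})" by (intro open_Times) auto
  show "(0, w) \<in> UNIV \<times> {- (1 / sqrt 2)<..}" using w by auto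
  fix y :: "real \<times> real" assume "y \<in> UNIV \<times> {- (1 / sqrt 2)<..}"
  then have "0 \<le> logit_jump y" by (auto simp: logit_jump_def gain_pos_iff[symmetric])
  then show "L (0, w) \<le> L y"
    using \<phi>_increasing[of 0 "logit_jump y"] \<open>a < 0\<close>
    by (cases "logit_jump y = 0") (auto simp: L_def logit_jump_def)
qed

text \<open>Here \<open>gain\<close> is negative nearby, so \<open>logit_jump\<close> is at most 0.
  The neighbourhood is also cut down to \<open>a < logit_jump y\<close>, because
  \<open>\<phi>\<close> is decreasing below \<open>a\<close>.\<close>

lemma local_maximum_axis:
  assumes "a < 0" and w: "w < - (1 / sqrt 2)"
  shows "local_maximum L (0, w)"
  unfolding local_maximum_def
proof (intro conjI exI ballI)
  let ?U = "UNIV \<times> {..< - (1 / sqrt 2)} \<inter> {y. a < logit_jump y}"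
  show "critical_point L (0, w)" by (rule critical_pointI) simp
  show "open ?U"
    unfolding logit_jump_def case_prod_beta
    by (intro open_Int open_Times open_Collect_less continuous_intros) auto
  show "(0, w) \<in> ?U" using assms by (auto simp: logit_jump_def)
  fix y :: "real \<times> real" assume y: "y \<in> ?U"
  then have "logit_jump y \<le> 0"
    by (auto simp: logit_jump_def gain_neg_iff[symmetric] mult_le_0_iff)
  then show "L y \<le> L (0, w)"
    using \<phi>_increasing[of "logit_jump y" 0] y
    by (cases "logit_jump y = 0") (auto simp: L_def logit_jump_def)
qed

lemma axis_not_global_minimum:
  assumes "a < 0" shows "\<not> global_minimum L (0, w)"
proof -
  \<comment> \<open>\<open>gain (- 1)\<close> is - 1, so \<open>e\<^sup>2 = - a\<close> makes the
    logit jump equal to \<open>a\<close>.\<close>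
  have "L (sqrt (- a), - 1) = \<phi> a" using assms by (simp add: L_def logit_jump_def gain_def)
  moreover have "L (0, w) = \<phi> 0" by (simp add: L_def logit_jump_def)
  ultimately have "L (sqrt (- a), - 1) < L (0, w)" using \<phi>_min[of 0] assms by simp
  then show ?thesis unfolding global_minimum_def by (meson not_le)
qed

end

lemma critical_imp_saddle: "critical_point f x \<Longrightarrow> saddle_point f x"
  unfolding saddle_point_def by blast

section \<open>Trajectories of the gradient flow\<close>

locale trajectory = potential +
  fixes e w :: "real \<Rightarrow> real"
  assumes e_ode: "t \<ge> 0 \<Longrightarrow>
      (e has_real_derivative - (\<phi>' ((e t)\<^sup>2 * gain (w t)) * (2 * e t * gain (w t)))) (at t within {0..})"
    and w_ode: "t \<ge> 0 \<Longrightarrow>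
      (w has_real_derivative - (\<phi>' ((e t)\<^sup>2 * gain (w t)) * (4 * (e t)\<^sup>2 * \<bar>w t\<bar>))) (at t within {0..})"
begin

definition A :: "real \<Rightarrow> real" where
  "A t = (e t)\<^sup>2 * gain (w t)"

lemma cont_e: "continuous_on {0..} e" and cont_w: "continuous_on {0..} w"
  by (rule halfline_continuous_on[OF e_ode], assumption)
    (rule halfline_continuous_on[OF w_ode], assumption)

lemma cont_A: "continuous_on {0..} A"
  unfolding A_def by (intro continuous_intros cont_e cont_w)

lemma cont_\<phi>'_A: "continuous_on {0..} (\<lambda>t. \<phi>' (A t))"
  using continuous_on_compose2[OF \<phi>'_cont cont_A] by simp

lemma sq_e_deriv:
  assumes "t \<ge> 0"
  shows "((\<lambda>t. (e t)\<^sup>2) has_real_derivative - (4 * (\<phi>' (A t) * (e t)\<^sup>2 * gain (w t)))) (at t within {0..})"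
  by (rule DERIV_cong[OF DERIV_power[OF e_ode[OF assms], of 2]])
    (simp add: A_def power2_eq_square algebra_simps)

text \<open>The bracket is the squared norm of the gradient of \<open>logit_jump\<close>, as for any
  gradient flow of a composition \<open>\<phi> (h y)\<close>.\<close>

lemma A_deriv:
  assumes "t \<ge> 0"
  shows "(A has_real_derivative - (\<phi>' (A t) * ((2 * e t * gain (w t))\<^sup>2 + (4 * (e t)\<^sup>2 * \<bar>w t\<bar>)\<^sup>2)))
    (at t within {0..})"
  unfolding A_def[abs_def]
  by (rule DERIV_cong[OF DERIV_mult[OF sq_e_deriv[OF assms] DERIV_chain2[OF gain_deriv w_ode[OF assms]]]])
    (simp add: A_def power2_eq_square algebra_simps)

lemma \<phi>_A_antimono:
  assumes "0 \<le> s" "s \<le> t"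
  shows "\<phi> (A t) \<le> \<phi> (A s)"
proof (rule halfline_nonincreasing[where r = 0 and f = "\<lambda>t. \<phi> (A t)" and f' =
    "\<lambda>u. \<phi>' (A u) * - (\<phi>' (A u) * ((2 * e u * gain (w u))\<^sup>2 + (4 * (e u)\<^sup>2 * \<bar>w u\<bar>)\<^sup>2))"])
  fix u :: real assume "u \<ge> 0"
  show "((\<lambda>t. \<phi> (A t)) has_real_derivative
      \<phi>' (A u) * - (\<phi>' (A u) * ((2 * e u * gain (w u))\<^sup>2 + (4 * (e u)\<^sup>2 * \<bar>w u\<bar>)\<^sup>2))) (at u within {0..})"
    by (rule DERIV_chain2[OF \<phi>_deriv A_deriv[OF \<open>u \<ge> 0\<close>]])
next
  fix u :: real
  have "0 \<le> (\<phi>' (A u))\<^sup>2 * ((2 * e u * gain (w u))\<^sup>2 + (4 * (e u)\<^sup>2 * \<bar>w u\<bar>)\<^sup>2)"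
    by (intro mult_nonneg_nonneg add_nonneg_nonneg) auto
  then show "\<phi>' (A u) * - (\<phi>' (A u) * ((2 * e u * gain (w u))\<^sup>2 + (4 * (e u)\<^sup>2 * \<bar>w u\<bar>)\<^sup>2)) \<le> 0"
    by (simp add: power2_eq_square mult.assoc)
qed (use assms in auto)

text \<open>
  \<open>A\<close> cannot cross \<open>a\<close>: as the loss does not increase along the flow, a trajectory that reaches the
  minimum of \<open>\<phi>\<close> stays there. This avoids a Lipschitz condition on \<open>\<phi>'\<close>.
\<close>

lemma A_stays_at:
  assumes "0 \<le> s" "s \<le> t" "A s = a"
  shows "A t = a"
  using \<phi>_A_antimono[OF assms(1,2)] \<phi>_min[of "A t"] assms(3) by force

lemma A_stays_above:
  assumes "a \<le> A 0" "0 \<le> t"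
  shows "a \<le> A t"
proof (rule ccontr)
  assume "\<not> a \<le> A t"
  moreover have "continuous_on {0..t} A" by (rule continuous_on_subset[OF cont_A]) auto
  ultimately obtain s where "0 \<le> s" "s \<le> t" "A s = a"
    using IVT2'[of A t a 0] assms by auto
  with A_stays_at[of s t] \<open>\<not> a \<le> A t\<close> show False by auto
qed

lemma A_stays_below:
  assumes "A 0 \<le> a" "0 \<le> t"
  shows "A t \<le> a"
proof (rule ccontr)
  assume "\<not> A t \<le> a"
  moreover have "continuous_on {0..t} A" by (rule continuous_on_subset[OF cont_A]) auto
  ultimately obtain s where "0 \<le> s" "s \<le> t" "A s = a"
    using IVT'[of A 0 a t] assms by auto
  with A_stays_at[of s t] \<open>\<not> A t \<le> a\<close> show False by auto
qed

text \<open>The equation for \<open>e\<close> is linear in \<open>e\<close> once \<open>A\<close>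
  and \<open>w\<close> are regarded as given. Later only the positivity of the factor matters, so
  the exponent is left unspecified.\<close>

lemma e_sol: "\<exists>C::real \<Rightarrow> real. \<forall>t\<ge>0. e t = e 0 * exp (C t)"
proof (intro exI allI impI)
  fix t :: real assume "t \<ge> 0"
  show "e t = e 0 * exp (integral {0..t} (\<lambda>t. - (2 * \<phi>' (A t) * gain (w t))))"
  proof (rule linear_ode_solution[OF _ _ \<open>t \<ge> 0\<close>])
    show "(e has_real_derivative - (2 * \<phi>' (A t) * gain (w t)) * e t) (at t within {0..})" if "t \<ge> 0" for t
      by (rule DERIV_cong[OF e_ode[OF that]]) (simp add: A_def)
    show "continuous_on {0..} (\<lambda>t. - (2 * \<phi>' (A t) * gain (w t)))"
      by (intro continuous_intros cont_\<phi>'_A cont_w)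
  qed
qed

lemma w_sign:
  assumes "t \<ge> 0"
  shows "w t < 0 \<longleftrightarrow> w 0 < 0"
proof -
  \<comment> \<open>\<open>z = min(w, 0)\<^sup>2\<close> is differentiable and solves a linear equation, although \<open>w\<close> itself does not.\<close>
  define z where "z t = ((w t)\<^sup>2 - w t * \<bar>w t\<bar>) / 2" for t
  define u where "u t = 8 * \<phi>' (A t) * (e t)\<^sup>2" for t
  have dz: "(z has_real_derivative u t * z t) (at t within {0..})" if "t \<ge> 0" for t
  proof -
    note w = w_ode[OF that]
    have "(z has_real_derivative ((2 * w t - 2 * \<bar>w t\<bar>) * - (\<phi>' (A t) * (4 * (e t)\<^sup>2 * \<bar>w t\<bar>))) / 2)
        (at t within {0..})"
      unfolding z_def[abs_def]
      by (rule DERIV_cong[OF DERIV_cdivide[OF DERIV_diff[OF DERIV_power[OF w, of 2]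
            DERIV_chain2[OF has_real_derivative_mult_abs w]]]])
        (simp add: A_def algebra_simps)
    then show ?thesis
      by (rule DERIV_cong, cases "w t \<ge> 0")
        (simp_all add: z_def u_def power2_eq_square algebra_simps)
  qed
  have "continuous_on {0..} u"
    unfolding u_def[abs_def] by (intro continuous_intros cont_\<phi>'_A cont_e)
  from linear_ode_solution[of z u, OF dz this assms]
  have "z t > 0 \<longleftrightarrow> z 0 > 0" by (simp add: zero_less_mult_iff)
  moreover have "z t > 0 \<longleftrightarrow> w t < 0" for t
    unfolding z_def by (cases "w t < 0") (auto simp: power2_eq_square intro: mult_neg_neg)
  ultimately show ?thesis by simp
qed

text \<open>By \<open>e_sol\<close> the sign of \<open>e\<close> is that of \<open>e 0\<close> at
  all times, so \<open>e\<close> is recovered from its square; for \<open>e 0 = 0\<close> both are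
  0.\<close>

lemma e_converges_if_square_converges:
  assumes "((\<lambda>t. (e t)\<^sup>2) \<longlongrightarrow> l) at_top"
  shows "\<exists>el. (e \<longlongrightarrow> el) at_top \<and> el\<^sup>2 = l"
proof -
  obtain C :: "real \<Rightarrow> real" where C: "\<And>t. t \<ge> 0 \<Longrightarrow> e t = e 0 * exp (C t)"
    using e_sol by blast
  have *: "sgn (e 0) * sqrt ((e t)\<^sup>2) = e t" if "t \<ge> 0" for t
    unfolding real_sqrt_abs C[OF that] abs_mult mult.assoc[symmetric] sgn_mult_abs by simp
  have "((\<lambda>t. sgn (e 0) * sqrt ((e t)\<^sup>2)) \<longlongrightarrow> sgn (e 0) * sqrt l) at_top"
    by (intro tendsto_intros assms)
  moreover have "\<forall>\<^sub>F t in at_top. sgn (e 0) * sqrt ((e t)\<^sup>2) = e t"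
    using eventually_ge_at_top[of 0] by eventually_elim (rule *)
  ultimately have e: "(e \<longlongrightarrow> sgn (e 0) * sqrt l) at_top" by (rule Lim_transform_eventually)
  have "(sgn (e 0) * sqrt l)\<^sup>2 = l"
    by (rule tendsto_unique[OF _ tendsto_power[OF e] assms]) simp
  with e show ?thesis by blast
qed

text \<open>By continuity of \<open>\<phi>'\<close> and \<open>gain\<close> the right-hand sides of
  both equations converge, and since \<open>e\<close> and \<open>w\<close> converge too, the limits
  must be 0.\<close>

lemma limit_critical:
  assumes e: "(e \<longlongrightarrow> el) at_top" and w: "(w \<longlongrightarrow> wl) at_top"
  shows "el = 0 \<or> el\<^sup>2 * gain wl = a"
proof -
  have "- (\<phi>' (el\<^sup>2 * gain wl) * (2 * el * gain wl)) = 0"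
    by (rule convergent_derivative_limit_zero[OF e_ode e])
      (auto intro!: tendsto_intros tendsto_\<phi>' e w)
  moreover have "- (\<phi>' (el\<^sup>2 * gain wl) * (4 * el\<^sup>2 * \<bar>wl\<bar>)) = 0"
    by (rule convergent_derivative_limit_zero[OF w_ode w])
      (auto intro!: tendsto_intros tendsto_\<phi>' e w)
  \<comment> \<open>So the two equations cannot both hold because of these factors:
    \<open>gain 0\<close> is 1. Either \<open>el\<close> or the value of \<open>\<phi>'\<close> is
    0.\<close>
  moreover have "gain wl \<noteq> 0 \<or> wl \<noteq> 0" by (auto simp: gain_def)
  ultimately show ?thesis by (auto simp: \<phi>'_eq_0_iff)
qed

lemma tendsto_A:
  "(e \<longlongrightarrow> el) at_top \<Longrightarrow> (w \<longlongrightarrow> wl) at_top \<Longrightarrow> (A \<longlongrightarrow> el\<^sup>2 * gain wl) at_top"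
  unfolding A_def[abs_def] by (intro tendsto_intros)

section \<open>Monotone coordinates and the conserved quantity\<close>

lemma w_nonincreasing:
  assumes "a \<le> A 0" "0 \<le> s" "s \<le> t"
  shows "w t \<le> w s"
  by (rule halfline_nonincreasing[OF w_ode, of 0 s t])
    (use assms A_stays_above \<phi>'_nonneg in \<open>auto simp: A_def\<close>)

lemma w_nondecreasing:
  assumes "A 0 \<le> a" "0 \<le> s" "s \<le> t"
  shows "w s \<le> w t"
  by (rule halfline_nondecreasing[OF w_ode, of 0 s t])
    (use assms A_stays_below \<phi>'_nonpos in \<open>auto simp: A_def mult_nonpos_nonneg\<close>)

lemma sq_e_nonincreasing:
  assumes "\<And>t. t \<ge> 0 \<Longrightarrow> \<phi>' (A t) * gain (w t) \<ge> 0" "0 \<le> s" "s \<le> t"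
  shows "(e t)\<^sup>2 \<le> (e s)\<^sup>2"
proof (rule halfline_nonincreasing[OF sq_e_deriv, of 0 s t])
  fix u :: real assume "u \<ge> 0"
  then have "(e u)\<^sup>2 * (\<phi>' (A u) * gain (w u)) \<ge> 0" using assms(1) by simp
  then show "- (4 * (\<phi>' (A u) * (e u)\<^sup>2 * gain (w u))) \<le> 0" by (simp add: mult_ac)
qed (use assms in auto)

lemma sq_e_nondecreasing:
  assumes "\<And>t. t \<ge> 0 \<Longrightarrow> \<phi>' (A t) * gain (w t) \<le> 0" "0 \<le> s" "s \<le> t"
  shows "(e s)\<^sup>2 \<le> (e t)\<^sup>2"
proof (rule halfline_nondecreasing[OF sq_e_deriv, of 0 s t])
  fix u :: real assume "u \<ge> 0"
  then have "(e u)\<^sup>2 * (\<phi>' (A u) * gain (w u)) \<le> 0"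
    using assms(1) by (simp add: mult_nonneg_nonpos)
  then show "0 \<le> - (4 * (\<phi>' (A u) * (e u)\<^sup>2 * gain (w u)))" by (simp add: mult_ac)
qed (use assms in auto)

text \<open>The derivatives of \<open>e\<^sup>2\<close> and \<open>w\<close> share the factor
  \<open>- 4 * \<phi>' (A t) * (e t)\<^sup>2\<close>. For \<open>w < 0\<close> their quotient is
  \<open>gain w / (- w) = 2 * w - 1 / w\<close>, a function of \<open>w\<close> with antiderivative
  \<open>w\<^sup>2 - ln (- w)\<close>.\<close>

lemma energy_conserved:
  assumes "w 0 < 0" "0 \<le> t"
  shows "(e t)\<^sup>2 - (w t)\<^sup>2 + ln (- w t) = (e 0)\<^sup>2 - (w 0)\<^sup>2 + ln (- w 0)"
proof (rule halfline_constant[OF _ assms(2)])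
  fix t :: real assume t: "t \<ge> 0"
  then have neg: "w t < 0" using w_sign assms(1) by simp
  note w = w_ode[OF t]
  have "((\<lambda>t. ln (- w t)) has_real_derivative
      1 / (- w t) * - (- (\<phi>' ((e t)\<^sup>2 * gain (w t)) * (4 * (e t)\<^sup>2 * \<bar>w t\<bar>)))) (at t within {0..})"
    by (rule DERIV_chain2[OF DERIV_ln_divide DERIV_minus[OF w]]) (use neg in simp)
  from DERIV_add[OF DERIV_diff[OF sq_e_deriv[OF t] DERIV_power[OF w, of 2]] this]
  show "((\<lambda>t. (e t)\<^sup>2 - (w t)\<^sup>2 + ln (- w t)) has_real_derivative 0) (at t within {0..})"
    by (rule DERIV_cong) (use neg in \<open>simp add: A_def gain_neg_arg field_simps power2_eq_square\<close>)
qed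

text \<open>With \<open>w \<ge> 0\<close> the gain is at least 1, so \<open>A\<close> is nonnegative
  and stays away from \<open>a < 0\<close>. Then \<open>w\<close> and \<open>e\<^sup>2\<close> are
  nonincreasing, and a critical limit can only lie on the axis.\<close>

lemma converges_nonneg:
  assumes "a < 0" "0 \<le> w 0"
  shows "\<exists>wl. (e \<longlongrightarrow> 0) at_top \<and> (w \<longlongrightarrow> wl) at_top \<and> 0 \<le> wl"
proof -
  have w: "0 \<le> w t" if "t \<ge> 0" for t using w_sign[OF that] assms(2) by linarith
  have g: "0 \<le> gain (w t)" if "t \<ge> 0" for t using gain_nonneg[OF w[OF that]] by linarith
  have A0: "a \<le> A 0" using mult_nonneg_nonneg[OF _ g[of 0], of "(e 0)\<^sup>2"] assms(1) by (simp add: A_def)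
  obtain wl where wl: "(w \<longlongrightarrow> wl) at_top"
    using nonincreasing_bounded_converges[of 0 w 0] w_nonincreasing[OF A0] w by blast
  have "\<exists>l. ((\<lambda>t. (e t)\<^sup>2) \<longlongrightarrow> l) at_top"
    by (rule nonincreasing_bounded_converges[of 0 _ 0], rule sq_e_nonincreasing)
      (auto intro!: mult_nonneg_nonneg \<phi>'_nonneg A_stays_above A0 g)
  then obtain el where el: "(e \<longlongrightarrow> el) at_top" using e_converges_if_square_converges by blast
  have "0 \<le> wl"
    by (rule tendsto_lowerbound[OF wl])
      (auto intro!: w eventually_mono[OF eventually_ge_at_top[of 0]])
  moreover have "el = 0"
    using limit_critical[OF el wl] gain_nonneg[OF \<open>0 \<le> wl\<close>] assms(1)
      mult_nonneg_nonneg[OF zero_le_power2, of "gain wl" el] by linarith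
  ultimately show ?thesis using el wl by blast
qed

text \<open>As \<open>w\<close> is nonincreasing, only a lower bound is missing. Convergence of
  \<open>e\<^sup>2\<close> then follows from the conserved quantity, which passes to the limit
  because \<open>wl \<le> w 0 < 0\<close> keeps the logarithm continuous.\<close>

lemma converges_neg:
  assumes "a < 0" "a \<le> A 0" "w 0 < 0"
  shows "\<exists>el wl. (e \<longlongrightarrow> el) at_top \<and> (w \<longlongrightarrow> wl) at_top \<and> wl \<le> w 0 \<and>
    el\<^sup>2 - wl\<^sup>2 + ln (- wl) = (e 0)\<^sup>2 - (w 0)\<^sup>2 + ln (- w 0)"
proof -
  define E where "E = (e 0)\<^sup>2 - (w 0)\<^sup>2 + ln (- w 0)"
  have E: "(e t)\<^sup>2 = E + (w t)\<^sup>2 - ln (- w t)" if "t \<ge> 0" for t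
    using energy_conserved[OF assms(3) that] by (simp add: E_def)
  \<comment> \<open>This is \<open>A\<close> as a function of \<open>v = w\<close> on the level set
    of \<open>E\<close>; its leading term is \<open>- 2 * v^4\<close>.\<close>
  have "filterlim (\<lambda>v. (E + v\<^sup>2 - ln (- v)) * (1 - 2 * v\<^sup>2)) at_bot at_bot" by real_asymp
  then have "\<forall>\<^sub>F v in at_bot. (E + v\<^sup>2 - ln (- v)) * (1 - 2 * v\<^sup>2) < a"
    by (rule filterlim_at_bot_dense[THEN iffD1, rule_format])
  then obtain W where W: "\<And>v. v \<le> W \<Longrightarrow> (E + v\<^sup>2 - ln (- v)) * (1 - 2 * v\<^sup>2) < a"
    by (auto simp: eventually_at_bot_linorder)
  have "W \<le> w t" if t: "t \<ge> 0" for t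
  proof (rule ccontr)
    assume "\<not> W \<le> w t"
    then have "A t < a" using W[of "w t"] w_sign[OF t] assms(3) by (simp add: A_def E[OF t] gain_neg_arg)
    with A_stays_above[OF assms(2) t] show False by simp
  qed
  then obtain wl where wl: "(w \<longlongrightarrow> wl) at_top"
    using nonincreasing_bounded_converges[of 0 w W] w_nonincreasing[OF assms(2)] by blast
  have le: "wl \<le> w 0"
    by (rule tendsto_upperbound[OF wl])
      (auto intro!: w_nonincreasing assms eventually_mono[OF eventually_ge_at_top[of 0]])
  have "((\<lambda>t. E + (w t)\<^sup>2 - ln (- w t)) \<longlongrightarrow> E + wl\<^sup>2 - ln (- wl)) at_top"
    using le assms(3) by (intro tendsto_intros wl) auto
  then have "((\<lambda>t. (e t)\<^sup>2) \<longlongrightarrow> E + wl\<^sup>2 - ln (- wl)) at_top"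
    by (rule Lim_transform_eventually) (auto intro!: eventually_mono[OF eventually_ge_at_top[of 0]] simp: E)
  then obtain el where "(e \<longlongrightarrow> el) at_top" "el\<^sup>2 = E + wl\<^sup>2 - ln (- wl)"
    using e_converges_if_square_converges by blast
  with wl le show ?thesis by (intro exI[of _ el] exI[of _ wl]) (simp add: E_def)
qed

text \<open>\<open>A \<le> a < 0\<close> forces \<open>gain\<close> to be negative, which bounds
  \<open>w\<close> above and makes \<open>e\<^sup>2\<close> nonincreasing. The inequality survives
  in the limit and rules out \<open>el = 0\<close>.\<close>

lemma converges_below:
  assumes "a < 0" "A 0 \<le> a"
  shows "\<exists>el wl. (e \<longlongrightarrow> el) at_top \<and> (w \<longlongrightarrow> wl) at_top \<and> el\<^sup>2 * gain wl = a"
proof -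
  have A: "A t \<le> a" if "t \<ge> 0" for t using A_stays_below that assms by blast
  have g: "gain (w t) < 0" if "t \<ge> 0" for t
    using A[OF that] assms(1) mult_nonneg_nonneg[of "(e t)\<^sup>2" "gain (w t)"] by (fastforce simp: A_def)
  have w: "w t \<le> 0" if "t \<ge> 0" for t using g[OF that] gain_nonneg[of "w t"] by linarith
  obtain wl where wl: "(w \<longlongrightarrow> wl) at_top"
    using nondecreasing_bounded_converges[of 0 w 0] w_nondecreasing[OF assms(2)] w by blast
  have "\<exists>l. ((\<lambda>t. (e t)\<^sup>2) \<longlongrightarrow> l) at_top"
    by (rule nonincreasing_bounded_converges[of 0 _ 0], rule sq_e_nonincreasing)
      (auto intro!: mult_nonpos_nonpos \<phi>'_nonpos A less_imp_le[OF g])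
  then obtain el where el: "(e \<longlongrightarrow> el) at_top" using e_converges_if_square_converges by blast
  have "el\<^sup>2 * gain wl \<le> a"
    by (rule tendsto_upperbound[OF tendsto_A[OF el wl]])
      (auto intro!: A eventually_mono[OF eventually_ge_at_top[of 0]])
  with assms(1) have "el \<noteq> 0" by auto
  with el wl limit_critical[OF el wl] show ?thesis by blast
qed

text \<open>If \<open>a \<le> A 0\<close>, then \<open>gain\<close> stays positive, which bounds
  \<open>w\<close> below, and both \<open>w\<close> and \<open>e\<^sup>2\<close> are nonincreasing.
  Otherwise both are nondecreasing and bound each other through \<open>A \<le> a\<close>:
  \<open>e\<^sup>2\<close> is at most \<open>a / gain (w 0)\<close>, and \<open>gain (w t)\<close>
  at most \<open>a / (e 0)\<^sup>2\<close>.\<close>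

lemma converges_global:
  assumes "0 < a" "e 0 \<noteq> 0" "0 < gain (w 0)"
  shows "\<exists>el wl. (e \<longlongrightarrow> el) at_top \<and> (w \<longlongrightarrow> wl) at_top \<and> el\<^sup>2 * gain wl = a"
proof (cases "a \<le> A 0")
  case True
  have A: "a \<le> A t" if "t \<ge> 0" for t using A_stays_above that True by blast
  have g: "gain (w t) > 0" if "t \<ge> 0" for t
    using A[OF that] assms(1) mult_nonneg_nonpos[of "(e t)\<^sup>2" "gain (w t)"] by (fastforce simp: A_def)
  have w: "- (1 / sqrt 2) \<le> w t" if "t \<ge> 0" for t using g[OF that] by (simp add: gain_pos_iff)
  obtain wl where wl: "(w \<longlongrightarrow> wl) at_top"
    using nonincreasing_bounded_converges[of 0 w "- (1 / sqrt 2)"] w_nonincreasing[OF True] w by blast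
  have "\<exists>l. ((\<lambda>t. (e t)\<^sup>2) \<longlongrightarrow> l) at_top"
    by (rule nonincreasing_bounded_converges[of 0 _ 0], rule sq_e_nonincreasing)
      (auto intro!: mult_nonneg_nonneg \<phi>'_nonneg A less_imp_le[OF g])
  then obtain el where el: "(e \<longlongrightarrow> el) at_top" using e_converges_if_square_converges by blast
  have "a \<le> el\<^sup>2 * gain wl"
    by (rule tendsto_lowerbound[OF tendsto_A[OF el wl]])
      (auto intro!: A eventually_mono[OF eventually_ge_at_top[of 0]])
  with assms(1) have "el \<noteq> 0" by auto
  with el wl limit_critical[OF el wl] show ?thesis by blast
next
  case False
  then have le: "A 0 \<le> a" by simp
  have A: "A t \<le> a" if "t \<ge> 0" for t using A_stays_below that le by blast
  have g: "gain (w 0) \<le> gain (w t)" if "t \<ge> 0" for t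
    using w_nondecreasing[OF le _ that] by (intro gain_mono) simp
  have g0: "0 \<le> gain (w t)" if "t \<ge> 0" for t using g[OF that] assms(3) by linarith
  have e: "(e 0)\<^sup>2 \<le> (e t)\<^sup>2" if "t \<ge> 0" for t
    using that
    by (intro sq_e_nondecreasing) (auto intro!: mult_nonpos_nonneg \<phi>'_nonpos A g0)
  have "(e t)\<^sup>2 \<le> a / gain (w 0)" if "t \<ge> 0" for t
    using mult_left_mono[OF g[OF that], of "(e t)\<^sup>2"] A[OF that] assms(3) by (simp add: A_def field_simps)
  then have "\<exists>l. ((\<lambda>t. (e t)\<^sup>2) \<longlongrightarrow> l) at_top"
    by (intro nondecreasing_bounded_converges[of 0]) 
      (auto intro!: sq_e_nondecreasing mult_nonpos_nonneg \<phi>'_nonpos A g0)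
  then obtain el where el: "(e \<longlongrightarrow> el) at_top" using e_converges_if_square_converges by blast
  \<comment> \<open>Above 1, \<open>w t\<close> is at most its square and hence at most
    \<open>gain (w t)\<close>; the summand 1 covers the other case.\<close>
  have "w t \<le> 1 + a / (e 0)\<^sup>2" if t: "t \<ge> 0" for t
  proof (cases "w t \<le> 1")
    case True then show ?thesis using assms by (auto intro: add_increasing2)
  next
    case False
    have "(e 0)\<^sup>2 * gain (w t) \<le> a"
      using mult_right_mono[OF e[OF t] g0[OF t]] A[OF t] by (simp add: A_def)
    then have "gain (w t) \<le> a / (e 0)\<^sup>2" using assms(2) by (simp add: field_simps)
    moreover have "gain (w t) = 1 + 2 * (w t * w t)" using False by (simp add: gain_def)
    moreover have "w t \<le> w t * w t" using False by simp
    ultimately show ?thesis using False by linarith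
  qed
  then obtain wl where wl: "(w \<longlongrightarrow> wl) at_top"
    using nondecreasing_bounded_converges[of 0 w] w_nondecreasing[OF le] by blast
  have "(e 0)\<^sup>2 \<le> el\<^sup>2"
    by (rule tendsto_lowerbound[OF tendsto_power[OF el]])
      (auto intro!: e eventually_mono[OF eventually_ge_at_top[of 0]])
  with assms(2) have "el \<noteq> 0" by auto
  with el wl limit_critical[OF el wl] show ?thesis by blast
qed

text \<open>Where \<open>gain\<close> is nonpositive the axis does not attract: \<open>w\<close>
  moves further left, \<open>gain\<close> stays nonpositive and \<open>e\<^sup>2\<close> cannot
  shrink. A start off the axis therefore has no limit on it.\<close>

lemma sq_e_lower_bound:
  assumes "a \<le> A 0" "gain (w 0) \<le> 0" "(e \<longlongrightarrow> el) at_top"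
  shows "(e 0)\<^sup>2 \<le> el\<^sup>2"
proof (rule tendsto_lowerbound[OF tendsto_power[OF assms(3)]])
  have g: "gain (w t) \<le> 0" if "t \<ge> 0" for t
    using gain_mono[OF w_nonincreasing[OF assms(1) _ that]] assms(2) by simp
  have "(e 0)\<^sup>2 \<le> (e t)\<^sup>2" if "t \<ge> 0" for t
    by (rule sq_e_nondecreasing[OF _ _ that])
      (auto intro!: mult_nonneg_nonpos \<phi>'_nonneg A_stays_above assms(1) g)
  then show "\<forall>\<^sub>F t in at_top. (e 0)\<^sup>2 \<le> (e t)\<^sup>2"
    by (intro eventually_mono[OF eventually_ge_at_top[of 0]])
qed simp

text \<open>\<open>e_sol\<close> keeps the trajectory on the axis, and the derivative of
  \<open>w\<close> carries the factor \<open>e\<^sup>2\<close>.\<close>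

lemma stationary_axis:
  assumes "e 0 = 0" "t \<ge> 0"
  shows "e t = 0" "w t = w 0"
proof -
  have e: "e t = 0" if "t \<ge> 0" for t using e_sol assms(1) that by auto
  then show "e t = 0" using assms(2) by simp
  show "w t = w 0"
  proof (rule halfline_constant[OF _ assms(2)])
    fix t :: real assume "t \<ge> 0"
    from w_ode[OF this] e[OF this] show "(w has_real_derivative 0) (at t within {0..})" by simp
  qed
qed

end

section \<open>Limits of the gradient flow\<close>

text \<open>The right-hand side is the conserved quantity at \<open>(0, w)\<close>. The bound is
  \<open>ln t \<le> t - 1\<close> at \<open>t = 2 * w\<^sup>2\<close>, sharp at
  \<open>t = 1\<close>, that is at the saddle.\<close>

lemma saddle_energy_le:
  assumes "w < 0"
  shows "E_sad \<ge> - w\<^sup>2 + ln (- w)"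
proof -
  have "ln (2 * (- w)\<^sup>2) \<le> 2 * (- w)\<^sup>2 - 1" using assms by (intro ln_le_minus_one) simp
  moreover have "ln (2 * (- w)\<^sup>2) = ln 2 + 2 * ln (- w)"
    using assms ln_mult[of 2 "(- w)\<^sup>2"] ln_realpow[of "- w" 2] by (simp del: power2_minus)
  ultimately show ?thesis by (simp add: E_sad_def field_simps)
qed

lemma E_sad_eq: "- (- (1 / sqrt 2))\<^sup>2 + ln (1 / sqrt 2) = E_sad"
  by (simp add: E_sad_def power_divide ln_div ln_sqrt field_simps)

text \<open>Squaring \<open>e = g w\<close> gives the level \<open>E_sad\<close> of the conserved
  quantity. As \<open>sqrt\<close> is strictly increasing on all reals, the radicands can be
  compared directly.\<close>

lemma abs_less_g_iff:
  assumes "w < 0"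
  shows "\<bar>e\<bar> < g w \<longleftrightarrow> e\<^sup>2 - w\<^sup>2 + ln (- w) < E_sad"
    and "g w < \<bar>e\<bar> \<longleftrightarrow> E_sad < e\<^sup>2 - w\<^sup>2 + ln (- w)"
proof -
  have "\<bar>e\<bar> < g w \<longleftrightarrow> sqrt (e\<^sup>2) < g w" by simp
  then show "\<bar>e\<bar> < g w \<longleftrightarrow> e\<^sup>2 - w\<^sup>2 + ln (- w) < E_sad"
    unfolding g_def real_sqrt_less_iff by auto
  have "g w < \<bar>e\<bar> \<longleftrightarrow> g w < sqrt (e\<^sup>2)" by simp
  then show "g w < \<bar>e\<bar> \<longleftrightarrow> E_sad < e\<^sup>2 - w\<^sup>2 + ln (- w)"
    unfolding g_def real_sqrt_less_iff by auto
qed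

lemma g_zero: "g (- (1 / sqrt 2)) = 0"
  using E_sad_eq by (simp add: g_def)

text \<open>These are the two mechanisms that keep a limit off the axis: a start off the axis where
  \<open>gain\<close> is negative, or a conserved quantity above all its values on the axis.\<close>

lemma I_star_cases:
  assumes "(e, w) \<in> I_star" "w < 0"
  shows "gain w < 0 \<and> e \<noteq> 0 \<or> E_sad < e\<^sup>2 - w\<^sup>2 + ln (- w)"
proof (cases "w < - (1 / sqrt 2)")
  case True
  then have "e \<noteq> 0" using assms by (auto simp: I_star_def I_max_def)
  with True show ?thesis by (simp add: gain_neg_iff)
next
  case False
  then have "\<not> (- (1 / sqrt 2) < w \<and> \<bar>e\<bar> < g w)" "\<bar>e\<bar> \<noteq> g w"
    using assms by (auto simp: I_star_def I_min_def I_sad_def abs_less_iff abs_if split: if_splits)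
  \<comment> \<open>At the endpoint \<open>g\<close> is 0, so
    \<open>\<bar>e\<bar> \<noteq> g w\<close> alone gives the strict inequality.\<close>
  then have "g w < \<bar>e\<bar>" using False g_zero by (cases "w = - (1 / sqrt 2)") auto
  then show ?thesis using abs_less_g_iff(2)[OF assms(2)] by blast
qed

text \<open>The line \<open>w = - (1 / sqrt 2)\<close> is a barrier: on it the conserved quantity is
  \<open>E_sad\<close> plus a square, but the trajectory carries a smaller value. A limit on the
  line is thus impossible, and a limit beyond it would require a crossing time.\<close>

lemma (in trajectory) I_min_limit_neg:
  assumes "a \<le> A 0" and I: "(e 0, w 0) \<in> I_min" "w 0 < 0"
    and w: "(w \<longlongrightarrow> wl) at_top"
    and en: "el\<^sup>2 - wl\<^sup>2 + ln (- wl) = (e 0)\<^sup>2 - (w 0)\<^sup>2 + ln (- w 0)"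
  shows "- (1 / sqrt 2) < wl"
proof (rule ccontr)
  let ?s = "- (1 / sqrt 2)"
  have w0: "?s < w 0" "\<bar>e 0\<bar> < g (w 0)" using I by (auto simp: I_min_def)
  then have E: "(e 0)\<^sup>2 - (w 0)\<^sup>2 + ln (- w 0) < E_sad" using abs_less_g_iff(1) I(2) by blast
  assume "\<not> ?s < wl"
  then consider "wl = ?s" | "wl < ?s" by linarith
  then show False
  proof cases
    case 1
    have "E_sad \<le> el\<^sup>2 - wl\<^sup>2 + ln (- wl)"
      using E_sad_eq zero_le_power2[of el] unfolding 1 minus_minus by linarith
    with E en show False by simp
  next
    case 2
    have "\<forall>\<^sub>F t in at_top. 0 \<le> t \<and> w t < ?s"
      using order_tendstoD(2)[OF w 2] eventually_ge_at_top[of 0] by eventually_elim simp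
    then obtain t where t: "0 \<le> t" "w t < ?s"
      using eventually_happens'[OF trivial_limit_at_top_linorder] by blast
    moreover have "continuous_on {0..t} w" by (rule continuous_on_subset[OF cont_w]) auto
    ultimately obtain u where u: "0 \<le> u" "w u = ?s" using IVT2'[of w t ?s 0] w0 by auto
    have "E_sad \<le> (e u)\<^sup>2 - (w u)\<^sup>2 + ln (- w u)" 
      using E_sad_eq zero_le_power2[of "e u"] unfolding u(2) minus_minus by linarith
    with E energy_conserved[OF I(2) u(1)] show False by simp
  qed
qed

context potential
begin

lemma gradient_flow_trajectory:
  assumes "gradient_flow L \<theta>"
  shows "trajectory \<phi> \<phi>' a (\<lambda>t. fst (\<theta> t)) (\<lambda>t. snd (\<theta> t))"
proof -
  obtain \<theta>' where \<theta>': "\<And>t. t \<ge> 0 \<Longrightarrow> (\<theta> has_vector_derivative \<theta>' t) (at t within {0..})"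
    "\<And>t. t \<ge> 0 \<Longrightarrow> GDERIV L (\<theta> t) :> - \<theta>' t"
    using assms unfolding gradient_flow_def by blast
  have eq: "\<theta>' t = - (\<phi>' ((fst (\<theta> t))\<^sup>2 * gain (snd (\<theta> t))) * (2 * fst (\<theta> t) * gain (snd (\<theta> t))),
      \<phi>' ((fst (\<theta> t))\<^sup>2 * gain (snd (\<theta> t))) * (4 * (fst (\<theta> t))\<^sup>2 * \<bar>snd (\<theta> t)\<bar>))" (is "_ = - ?G t")
    if "t \<ge> 0" for t
  proof -
    have "GDERIV L (\<theta> t) :> ?G t" using gradient[of "fst (\<theta> t)" "snd (\<theta> t)"] by simp
    then have "(\<lambda>h. inner h (- \<theta>' t)) = (\<lambda>h. inner h (?G t))"
      using \<theta>'(2)[OF that] unfolding gderiv_def by (rule has_derivative_unique[rotated])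
    then have "- \<theta>' t = ?G t" by (metis vector_eq_ldot)
    then show ?thesis by (metis minus_minus)
  qed
  show ?thesis
  proof unfold_locales
    fix t :: real assume t: "0 \<le> t"
    from \<theta>'(1)[OF t] have d: "(\<theta> has_derivative (\<lambda>x. x *\<^sub>R \<theta>' t)) (at t within {0..})"
      by (simp add: has_vector_derivative_def)
    show "((\<lambda>t. fst (\<theta> t)) has_real_derivative - (\<phi>' ((fst (\<theta> t))\<^sup>2 * gain (snd (\<theta> t))) *
        (2 * fst (\<theta> t) * gain (snd (\<theta> t))))) (at t within {0..})"
      unfolding has_field_derivative_def
      by (rule has_derivative_eq_rhs[OF has_derivative_fst[OF d]]) (auto simp: eq[OF t] fun_eq_iff)
    show "((\<lambda>t. snd (\<theta> t)) has_real_derivative - (\<phi>' ((fst (\<theta> t))\<^sup>2 * gain (snd (\<theta> t))) *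
        (4 * (fst (\<theta> t))\<^sup>2 * \<bar>snd (\<theta> t)\<bar>))) (at t within {0..})"
      unfolding has_field_derivative_def
      by (rule has_derivative_eq_rhs[OF has_derivative_snd[OF d]]) (auto simp: eq[OF t] fun_eq_iff)
  qed
qed

theorem flow_limit_bistable:
  assumes "a < 0" "gradient_flow L \<theta>"
  shows "\<exists>\<theta>lim. (\<theta> \<longlongrightarrow> \<theta>lim) at_top \<and> critical_point L \<theta>lim \<and>
    (\<theta> 0 \<in> I_min \<longrightarrow> local_minimum L \<theta>lim \<and> \<not> global_minimum L \<theta>lim) \<and>
    (\<theta> 0 \<in> I_sad \<longrightarrow> saddle_point L \<theta>lim) \<and>
    (\<theta> 0 \<in> I_max \<longrightarrow> local_maximum L \<theta>lim) \<and>
    (\<theta> 0 \<in> I_star \<longrightarrow> global_minimum L \<theta>lim)"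
proof -
  interpret trajectory \<phi> \<phi>' a "\<lambda>t. fst (\<theta> t)" "\<lambda>t. snd (\<theta> t)"
    by (rule gradient_flow_trajectory[OF assms(2)])
  define e0 w0 where "e0 = fst (\<theta> 0)" and "w0 = snd (\<theta> 0)"
  have \<theta>0: "\<theta> 0 = (e0, w0)" by (simp add: e0_def w0_def)
  have A0: "A 0 = e0\<^sup>2 * gain w0" by (simp add: A_def e0_def w0_def)
  \<comment> \<open>A critical limit lies on the axis or is a global minimum. What remains is that
    starts in \<open>I_min\<close> and \<open>I_max\<close> end on the axis, on the correct side of
    the saddle, and that starts in \<open>I_star\<close> end off it.\<close>
  have *: ?thesis if "((\<lambda>t. fst (\<theta> t)) \<longlongrightarrow> el) at_top" "((\<lambda>t. snd (\<theta> t)) \<longlongrightarrow> wl) at_top"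
    "(e0, w0) \<in> I_min \<Longrightarrow> el = 0 \<and> - (1 / sqrt 2) < wl"
    "(e0, w0) \<in> I_max \<Longrightarrow> el = 0 \<and> wl < - (1 / sqrt 2)"
    "(e0, w0) \<in> I_star \<Longrightarrow> el \<noteq> 0" for el wl
  proof (intro exI[of _ "(el, wl)"] conjI impI)
    show "(\<theta> \<longlongrightarrow> (el, wl)) at_top" using tendsto_Pair[OF that(1,2)] by simp
    note crit = limit_critical[OF that(1,2)]
    then show "critical_point L (el, wl)" by (intro critical_pointI) (simp add: logit_jump_def)
    then show "saddle_point L (el, wl)" by (rule critical_imp_saddle)
    show "local_minimum L (el, wl)" if "\<theta> 0 \<in> I_min"
      using that \<open>(e0, w0) \<in> I_min \<Longrightarrow> _\<close> local_minimum_axis[OF assms(1)] \<theta>0 by simp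
    show "\<not> global_minimum L (el, wl)" if "\<theta> 0 \<in> I_min"
      using that \<open>(e0, w0) \<in> I_min \<Longrightarrow> _\<close> axis_not_global_minimum[OF assms(1)] \<theta>0 by simp
    show "local_maximum L (el, wl)" if "\<theta> 0 \<in> I_max"
      using that \<open>(e0, w0) \<in> I_max \<Longrightarrow> _\<close> local_maximum_axis[OF assms(1)] \<theta>0 by simp
    show "global_minimum L (el, wl)" if "\<theta> 0 \<in> I_star"
      using that \<open>(e0, w0) \<in> I_star \<Longrightarrow> _\<close> crit \<theta>0 by (intro global_minimumI) (simp add: logit_jump_def)
  qed
  have neg: "w < 0" if "w < - (1 / sqrt 2)" for w :: real using that by (rule less_trans) simp
  consider "w0 \<ge> 0" | "w0 < 0" "A 0 < a" | "w0 < 0" "a \<le> A 0" "e0 = 0" | "w0 < 0" "a \<le> A 0" "e0 \<noteq> 0"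
    by linarith
  then show ?thesis
  proof cases
    case 1
    then obtain wl where "((\<lambda>t. fst (\<theta> t)) \<longlongrightarrow> 0) at_top" "((\<lambda>t. snd (\<theta> t)) \<longlongrightarrow> wl) at_top" "0 \<le> wl"
      using converges_nonneg[OF assms(1)] by (auto simp: w0_def)
    moreover have "- (1 / sqrt 2) < wl" using \<open>0 \<le> wl\<close> by (rule less_le_trans[rotated]) simp
    moreover have "(e0, w0) \<notin> I_max" using 1 neg[of w0] by (auto simp: I_max_def)
    moreover have "(e0, w0) \<notin> I_star" using 1 by (auto simp: I_star_def I_min_def)
    ultimately show ?thesis by (intro *) auto
  next
    case 2
    then obtain el wl where l: "((\<lambda>t. fst (\<theta> t)) \<longlongrightarrow> el) at_top" "((\<lambda>t. snd (\<theta> t)) \<longlongrightarrow> wl) at_top"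
      "el\<^sup>2 * gain wl = a" using converges_below[OF assms(1)] by auto
    \<comment> \<open>\<open>A 0 < a < 0\<close> puts the start off the axis and to the left of the
      saddle.\<close>
    have "gain w0 < 0 \<and> e0 \<noteq> 0"
      using 2(2) assms(1) mult_nonneg_nonneg[of "e0\<^sup>2" "gain w0"] by (fastforce simp: A0)
    then have "(e0, w0) \<notin> I_min" "(e0, w0) \<notin> I_max"
      using 2(1) by (auto simp: I_min_def I_max_def gain_neg_iff)
    moreover have "el \<noteq> 0" using l(3) assms(1) by auto
    ultimately show ?thesis by (intro *[OF l(1,2)]) auto
  next
    case 3
    have e: "fst (\<theta> t) = 0" "snd (\<theta> t) = w0" if "t \<ge> 0" for t
      using stationary_axis[OF _ that] 3(3) by (auto simp: e0_def w0_def)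
    have "((\<lambda>t. fst (\<theta> t)) \<longlongrightarrow> 0) at_top" "((\<lambda>t. snd (\<theta> t)) \<longlongrightarrow> w0) at_top"
      by (auto intro!: tendsto_eventually eventually_mono[OF eventually_ge_at_top[of 0]] e)
    moreover have "(e0, w0) \<notin> I_star"
    proof
      assume "(e0, w0) \<in> I_star"
      then show False
        using I_star_cases[of 0 w0] 3 saddle_energy_le[OF 3(1)] by auto
    qed
    ultimately show ?thesis using 3 by (intro *) (auto simp: I_min_def I_max_def)
  next
    case 4
    then obtain el wl where l: "((\<lambda>t. fst (\<theta> t)) \<longlongrightarrow> el) at_top" "((\<lambda>t. snd (\<theta> t)) \<longlongrightarrow> wl) at_top"
      "wl \<le> w0" "el\<^sup>2 - wl\<^sup>2 + ln (- wl) = e0\<^sup>2 - w0\<^sup>2 + ln (- w0)"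
      using converges_neg[OF assms(1) 4(2)] by (auto simp: w0_def e0_def)
    show ?thesis
    proof (rule *[OF l(1,2)])
      assume I: "(e0, w0) \<in> I_min"
      have wl: "- (1 / sqrt 2) < wl"
        using I_min_limit_neg[OF 4(2) _ _ l(2), of el] I 4(1) l(4) by (simp add: w0_def e0_def)
      \<comment> \<open>Hence the limit jump cannot be \<open>a < 0\<close>, and the limit is on the
        axis.\<close>
      then have "0 \<le> el\<^sup>2 * gain wl" by (simp add: gain_pos_iff[symmetric] less_imp_le)
      then show "el = 0 \<and> - (1 / sqrt 2) < wl"
        using limit_critical[OF l(1,2)] assms(1) wl by auto
    next
      assume "(e0, w0) \<in> I_max"
      then show "el = 0 \<and> wl < - (1 / sqrt 2)" using 4 by (simp add: I_max_def)
    next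
      assume "(e0, w0) \<in> I_star"
      then consider "gain w0 < 0" | "E_sad < e0\<^sup>2 - w0\<^sup>2 + ln (- w0)"
        using I_star_cases[OF _ 4(1)] by blast
      then show "el \<noteq> 0"
      proof cases
        case 1
        then have "e0\<^sup>2 \<le> el\<^sup>2"
          using sq_e_lower_bound[OF 4(2) _ l(1)] by (simp add: e0_def w0_def)
        then show ?thesis using 4(3) by auto
      next
        case 2
        \<comment> \<open>With \<open>el = 0\<close> the conserved quantity would be at most
          \<open>E_sad\<close>.\<close>
        then show ?thesis using saddle_energy_le[of wl] l(3,4) 4(1) by auto
      qed
    qed
  qed
qed

theorem flow_limit_global:
  assumes "0 < a" "gradient_flow L \<theta>" "fst (\<theta> 0) \<noteq> 0" "- (1 / sqrt 2) < snd (\<theta> 0)"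
  shows "\<exists>\<theta>lim. (\<theta> \<longlongrightarrow> \<theta>lim) at_top \<and> global_minimum L \<theta>lim"
proof -
  interpret trajectory \<phi> \<phi>' a "\<lambda>t. fst (\<theta> t)" "\<lambda>t. snd (\<theta> t)"
    by (rule gradient_flow_trajectory[OF assms(2)])
  obtain el wl where l: "((\<lambda>t. fst (\<theta> t)) \<longlongrightarrow> el) at_top" "((\<lambda>t. snd (\<theta> t)) \<longlongrightarrow> wl) at_top"
    "el\<^sup>2 * gain wl = a"
    using converges_global[OF assms(1,3)] assms(4) by (auto simp: gain_pos_iff)
  have "(\<theta> \<longlongrightarrow> (el, wl)) at_top" using tendsto_Pair[OF l(1,2)] by simp
  moreover have "global_minimum L (el, wl)"
    using l(3) by (intro global_minimumI) (simp add: logit_jump_def)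
  ultimately show ?thesis by blast
qed

end

section \<open>The loss as a function of the logit jump\<close>

definition sigmoid :: "real \<Rightarrow> real" where
  "sigmoid u = 1 / (1 + exp (- u))"

lemma one_plus_exp_neq_0 [simp]: "1 + exp (u::real) \<noteq> 0"
  using exp_gt_zero[of u] by linarith

lemma sigmoid_exp: "sigmoid u = exp u / (1 + exp u)"
  by (simp add: sigmoid_def exp_minus field_simps)

lemma sigmoid_strict_mono: "u < v \<Longrightarrow> sigmoid u < sigmoid v"
  by (simp add: sigmoid_def frac_less2 add_pos_pos)

lemma log_loss_deriv: "(log_loss has_real_derivative sigmoid u - 1) (at u)"
  unfolding log_loss_def[abs_def] sigmoid_def
  by (rule derivative_eq_intros refl add_pos_pos | simp)+ (simp add: field_simps)

lemma log_loss_deriv_minus: "((\<lambda>u. log_loss (- u)) has_real_derivative sigmoid u) (at u)"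
  by (rule DERIV_cong[OF DERIV_chain2[OF log_loss_deriv DERIV_minus[OF DERIV_ident]]])
    (simp add: sigmoid_def exp_minus field_simps)

definition cross_entropy :: "real \<Rightarrow> real \<Rightarrow> real" where
  "cross_entropy c u = c * log_loss u + (1 - c) * log_loss (- u)"

lemma cross_entropy_deriv: "(cross_entropy c has_real_derivative sigmoid u - c) (at u)"
  unfolding cross_entropy_def[abs_def]
  by (rule DERIV_cong[OF DERIV_add[OF DERIV_cmult[OF log_loss_deriv] DERIV_cmult[OF log_loss_deriv_minus]]])
    (simp add: algebra_simps)

locale switching_probs =
  fixes p q :: real
  assumes p: "0 < p" "p < 1" and q: "0 < q" "q < 1"
begin

text \<open>Here \<open>u\<close> is the logit after the symbol 0 and \<open>u + x\<close> the logit after the symbol 1.\<close>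

definition F :: "real \<Rightarrow> real \<Rightarrow> real" where
  "F x u = q / (p + q) * cross_entropy p u + p / (p + q) * cross_entropy (1 - q) (u + x)"

text \<open>Discriminant of \<open>q * exp x * r\<^sup>2 + (q - p) * r - p\<close>, the quadratic in
  \<open>r = exp u\<close> that expresses optimality of \<open>u\<close>.\<close>

definition disc :: "real \<Rightarrow> real" where
  "disc x = (p - q)\<^sup>2 + 4 * p * q * exp x"

text \<open>
  The optimality condition \<open>q \<cdot> sigmoid u + p \<cdot> sigmoid (u + x) = p\<close> is a quadratic equation in
  \<open>exp u\<close>; this is the logarithm of its positive root.
\<close>

definition opt :: "real \<Rightarrow> real" where
  "opt x = ln (2 * p / (q - p + sqrt (disc x)))"

definition \<phi> :: "real \<Rightarrow> real" where
  "\<phi> x = F x (opt x)"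

definition \<phi>' :: "real \<Rightarrow> real" where
  "\<phi>' x = q / (p + q) * (p - sigmoid (opt x))"

text \<open>The jump at which both predictions are exact: the logit of \<open>1 - q\<close> minus
  the logit of \<open>p\<close>.\<close>

definition a :: real where
  "a = ln ((1 - p) * (1 - q) / (p * q))"

section \<open>The optimal logit and the minimal value\<close>

lemma disc_pos: "disc x > 0"
  unfolding disc_def using p q by (intro add_nonneg_pos mult_pos_pos) auto

lemma root_pos: "q - p + sqrt (disc x) > 0"
proof -
  have "\<bar>p - q\<bar> < sqrt (disc x)"
    by (rule real_less_rsqrt) (use p q in \<open>simp add: disc_def\<close>)
  then show ?thesis by linarith
qed

lemma exp_opt: "exp (opt x) = 2 * p / (q - p + sqrt (disc x))"
  unfolding opt_def using root_pos p by (intro exp_ln) simp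

lemma opt_equation: "q * sigmoid (opt x) + p * sigmoid (opt x + x) = p"
proof -
  define r y d where "r = exp (opt x)" and "y = exp x" and "d = sqrt (disc x)"
  have d: "d\<^sup>2 = (p - q)\<^sup>2 + 4 * p * q * y" "q - p + d > 0"
    using disc_pos[of x] root_pos[of x] by (simp_all add: d_def y_def disc_def)
  have pos: "r > 0" "y > 0" by (simp_all add: r_def y_def)
  have r: "r * (q - p + d) = 2 * p" using d(2) by (simp add: r_def exp_opt d_def)
  \<comment> \<open>\<open>r\<close> is given in the rationalised form
    \<open>2 * p / (q - p + d)\<close>; multiplying by the conjugate leads back to the quadratic
    \<open>quad\<close>.\<close>
  have "4 * p * q * y = (d - (q - p)) * (d + (q - p))" using d(1) by (simp add: power2_eq_square algebra_simps)
  then have "4 * p * q * y * r = (d - (q - p)) * (d + (q - p)) * r" by simp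
  also have "\<dots> = (d - (q - p)) * (r * (q - p + d))" by (simp add: algebra_simps)
  finally have "4 * p * q * y * r = (d - (q - p)) * (r * (q - p + d))" .
  then have "2 * p * (2 * q * y * r) = 2 * p * (d - (q - p))" unfolding r by (simp add: algebra_simps)
  then have "2 * q * y * r = d - (q - p)" using p by (simp only: mult_cancel_left) simp
  then have "2 * q * y * r * r = (d - (q - p)) * r" by simp
  then have "2 * q * y * r\<^sup>2 = (d - (q - p)) * r" by (simp add: power2_eq_square mult.assoc)
  then have quad: "q * y * r\<^sup>2 + (q - p) * r - p = 0" using r by (simp add: algebra_simps)
  have ry: "1 + r \<noteq> 0" "1 + r * y \<noteq> 0" using pos mult_pos_pos[OF pos] by linarith+
  \<comment> \<open>Abstract denominators keep \<open>1 + r\<close> and \<open>1 + r * y\<close>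
    from being expanded.\<close>
  have "q * (r / s) + p * (z / v) - p = (q * r * v + p * z * s - p * s * v) / (s * v)"
    if "s \<noteq> 0" "v \<noteq> 0" for s v z
    using that by (simp add: field_simps)
  from this[OF ry, of "r * y"]
  have "q * (r / (1 + r)) + p * (r * y / (1 + r * y)) - p =
      (q * y * r\<^sup>2 + (q - p) * r - p) / ((1 + r) * (1 + r * y))"
    by (simp add: algebra_simps power2_eq_square)
  then have "q * (r / (1 + r)) + p * (r * y / (1 + r * y)) = p" unfolding quad by simp
  then show ?thesis by (simp add: sigmoid_exp exp_add r_def y_def)
qed

lemma F_deriv:
  "(F x has_real_derivative (q * sigmoid u + p * sigmoid (u + x) - p) / (p + q)) (at u)"
proof -
  have "(F x has_real_derivative q / (p + q) * (sigmoid u - p) + p / (p + q) * (sigmoid (u + x) - (1 - q))) (at u)"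
    unfolding F_def[abs_def]
    by (rule DERIV_cong[OF DERIV_add[OF DERIV_cmult[OF cross_entropy_deriv]
            DERIV_cmult[OF DERIV_chain2[OF cross_entropy_deriv DERIV_add[OF DERIV_ident DERIV_const]]]]])
      simp
  then show ?thesis
    by (rule DERIV_cong) (simp add: algebra_simps flip: add_divide_distrib diff_divide_distrib)
qed

text \<open>The derivative \<open>D\<close> is nondecreasing, as a positive combination of sigmoids
  minus a constant, and vanishes at \<open>opt x\<close>.\<close>

lemma F_min: "F x (opt x) \<le> F x u"
proof -
  define D where "D v = (q * sigmoid v + p * sigmoid (v + x) - p) / (p + q)" for v
  have D: "D (opt x) = 0" by (simp add: D_def opt_equation)
  have mono: "D v \<le> D v'" if "v \<le> v'" for v v'
    using that p q sigmoid_strict_mono[of v v'] sigmoid_strict_mono[of "v + x" "v' + x"]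
    by (cases "v = v'") (auto simp: D_def intro!: divide_right_mono add_mono)
  have d: "(F x has_real_derivative D v) (at v)" for v unfolding D_def by (rule F_deriv)
  show ?thesis
  proof (cases "opt x \<le> u")
    case True
    then show ?thesis
      by (rule DERIV_nonneg_imp_nondecreasing) (use d mono D in metis)
  next
    case False
    then have "u \<le> opt x" by simp
    then show ?thesis
      by (rule DERIV_nonpos_imp_nonincreasing) (use d mono D in metis)
  qed
qed

lemma opt_differentiable: "\<exists>d. (opt has_real_derivative d) (at x)"
proof -
  have "(disc has_real_derivative 4 * p * q * exp x) (at x)"
    unfolding disc_def[abs_def] by (auto intro!: derivative_eq_intros)
  from DERIV_chain2[OF DERIV_real_sqrt[OF disc_pos] this]
  have "((\<lambda>x. q - p + sqrt (disc x)) has_real_derivative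
      0 + inverse (sqrt (disc x)) / 2 * (4 * p * q * exp x)) (at x)"
    by (intro DERIV_add DERIV_const)
  from DERIV_divide[OF DERIV_const this, of "2 * p"] root_pos[of x]
  obtain d where "((\<lambda>x. 2 * p / (q - p + sqrt (disc x))) has_real_derivative d) (at x)" by auto
  from DERIV_chain2[OF DERIV_ln this] root_pos[of x] p
  show ?thesis unfolding opt_def[abs_def] by auto
qed

text \<open>Envelope argument: at the optimum the terms with the derivative \<open>d\<close> of
  \<open>opt\<close> cancel, so its value is irrelevant. The remaining partial derivative in
  \<open>x\<close> is rewritten by \<open>opt_equation\<close>.\<close>

lemma \<phi>_deriv: "(\<phi> has_real_derivative \<phi>' x) (at x)"
proof -
  obtain d where d: "(opt has_real_derivative d) (at x)" using opt_differentiable by blast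
  have "(\<phi> has_real_derivative q / (p + q) * ((sigmoid (opt x) - p) * d) +
      p / (p + q) * ((sigmoid (opt x + x) - (1 - q)) * (d + 1))) (at x)"
    unfolding \<phi>_def[abs_def] F_def
    by (intro DERIV_add DERIV_cmult DERIV_chain2[OF cross_entropy_deriv] d DERIV_ident)
  moreover have "p * (sigmoid (opt x + x) - (1 - q)) = - (q * (sigmoid (opt x) - p))"
    using opt_equation[of x] by (simp add: algebra_simps)
  then have "q / (p + q) * ((sigmoid (opt x) - p) * d) +
      p / (p + q) * ((sigmoid (opt x + x) - (1 - q)) * (d + 1)) = \<phi>' x"
    using p q unfolding \<phi>'_def by (simp add: divide_simps) algebra
  ultimately show ?thesis by simp
qed

lemma \<phi>'_cont: "continuous_on UNIV \<phi>'"
proof -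
  have "continuous_on UNIV opt"
    using opt_differentiable by (auto intro!: continuous_at_imp_continuous_on intro: DERIV_isCont)
  then show ?thesis
    unfolding \<phi>'_def[abs_def] sigmoid_def using one_plus_exp_neq_0 by (intro continuous_intros) auto
qed

text \<open>Since \<open>sigmoid (opt x)\<close> is \<open>2 * p / (q + p + sqrt (disc x))\<close>,
  both claims compare \<open>sqrt (disc x)\<close> with \<open>2 - p - q\<close>.\<close>

lemma sigmoid_opt_less_iff: "sigmoid (opt x) < p \<longleftrightarrow> a < x"
  and sigmoid_opt_greater_iff: "p < sigmoid (opt x) \<longleftrightarrow> x < a"
proof -
  let ?d = "sqrt (disc x)"
  have s: "sigmoid (opt x) = 2 * p / (q + p + ?d)"
    using root_pos[of x] by (simp add: sigmoid_exp exp_opt divide_simps)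
  have pos: "q + p + ?d > 0" using root_pos[of x] p by linarith
  have 2: "0 \<le> 2 - p - q" using p q by linarith
  have ea: "exp a = (1 - p) * (1 - q) / (p * q)" unfolding a_def using p q by (intro exp_ln) simp
  obtain k where k: "k > 0" "k = 4 * (p * q)" using p q by simp
  \<comment> \<open>At \<open>x = a\<close> the discriminant is the perfect square \<open>(p -
    q)\<^sup>2 + 4 * (1 - p) * (1 - q) = (2 - p - q)\<^sup>2\<close>.\<close>
  have disc: "disc x - (2 - p - q)\<^sup>2 = k * (exp x - exp a)"
    using p q by (simp add: k(2) ea disc_def field_simps power2_eq_square)
  have "sigmoid (opt x) < p \<longleftrightarrow> 2 - p - q < ?d"
    using p pos by (auto simp: s divide_less_eq)
  also have "\<dots> \<longleftrightarrow> (2 - p - q)\<^sup>2 < disc x"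
    using 2 disc_pos[of x] by (metis less_imp_le real_sqrt_less_iff real_sqrt_unique)
  also have "\<dots> \<longleftrightarrow> 0 < k * (exp x - exp a)" unfolding disc[symmetric] by simp
  also have "\<dots> \<longleftrightarrow> a < x" using k(1) by (simp add: zero_less_mult_iff)
  finally show "sigmoid (opt x) < p \<longleftrightarrow> a < x" .
  have "p < sigmoid (opt x) \<longleftrightarrow> ?d < 2 - p - q"
    using p pos by (auto simp: s less_divide_eq)
  also have "\<dots> \<longleftrightarrow> disc x < (2 - p - q)\<^sup>2"
    using 2 disc_pos[of x] by (metis less_imp_le real_sqrt_less_iff real_sqrt_unique)
  also have "\<dots> \<longleftrightarrow> k * (exp x - exp a) < 0" unfolding disc[symmetric] by simp
  also have "\<dots> \<longleftrightarrow> x < a" using k(1) by (simp add: mult_less_0_iff)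
  finally show "p < sigmoid (opt x) \<longleftrightarrow> x < a" .
qed

lemma a_neg_iff: "a < 0 \<longleftrightarrow> 1 < p + q" and a_pos_iff: "0 < a \<longleftrightarrow> p + q < 1"
proof -
  have "0 < (1 - p) * (1 - q) / (p * q)" using p q by simp
  moreover have "(1 - p) * (1 - q) = p * q + (1 - (p + q))" by (simp add: algebra_simps)
  ultimately show "a < 0 \<longleftrightarrow> 1 < p + q" "0 < a \<longleftrightarrow> p + q < 1"
    using p q by (simp_all add: a_def divide_less_eq less_divide_eq)
qed

sublocale potential \<phi> \<phi>' a
proof
  fix x
  show "(\<phi> has_real_derivative \<phi>' x) (at x)" by (rule \<phi>_deriv)
  show "continuous_on UNIV \<phi>'" by (rule \<phi>'_cont)
  show "\<phi>' x > 0" if "a < x"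
    using that p q sigmoid_opt_less_iff[of x] by (simp add: \<phi>'_def)
  show "\<phi>' x < 0" if "x < a"
    using that p q sigmoid_opt_greater_iff[of x] by (simp add: \<phi>'_def mult_less_0_iff divide_less_0_iff)
qed

end

section \<open>Marginals of the chain\<close>

text \<open>The integrand is a combination of the indicators of the four joint events.\<close>

lemma (in prob_space) integral_two_binary:
  fixes Y Z :: "'a \<Rightarrow> nat" and f :: "nat \<Rightarrow> nat \<Rightarrow> real"
  assumes Y: "Y \<in> measurable M (count_space {0, 1})" and Z: "Z \<in> measurable M (count_space {0, 1})"
  shows "(\<integral>\<omega>. f (Y \<omega>) (Z \<omega>) \<partial>M) =
    (\<Sum>i\<in>{0, 1}. \<Sum>j\<in>{0, 1}. f i j * prob {\<omega> \<in> space M. Z \<omega> = j \<and> Y \<omega> = i})"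
proof -
  have YZ: "Y \<omega> \<in> {0, 1}" "Z \<omega> \<in> {0, 1}" if "\<omega> \<in> space M" for \<omega>
    using measurable_space[OF Y that] measurable_space[OF Z that] by simp_all
  have ev: "{\<omega> \<in> space M. Z \<omega> = j \<and> Y \<omega> = i} \<in> sets M" if "i \<in> {0, 1}" "j \<in> {0, 1}" for i j
  proof -
    have "{\<omega> \<in> space M. Z \<omega> = j \<and> Y \<omega> = i} = (Z -` {j} \<inter> space M) \<inter> (Y -` {i} \<inter> space M)" by auto
    then show ?thesis using that measurable_sets[OF Y, of "{i}"] measurable_sets[OF Z, of "{j}"] by auto
  qed
  define S where "S i j = {\<omega> \<in> space M. Z \<omega> = j \<and> Y \<omega> = i}" for i j
  have S: "S i j \<in> sets M" if "i \<in> {0, 1}" "j \<in> {0, 1}" for i j unfolding S_def by (rule ev[OF that])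
  have int: "integrable M (\<lambda>\<omega>. f i j * indicator (S i j) \<omega>)" if "i \<in> {0, 1}" "j \<in> {0, 1}" for i j
    using S[OF that] by (intro integrable_mult_right integrable_real_indicator) (auto simp: less_top[symmetric])
  have "(\<integral>\<omega>. f (Y \<omega>) (Z \<omega>) \<partial>M) =
      (\<integral>\<omega>. (\<Sum>i\<in>{0, 1}. \<Sum>j\<in>{0, 1}. f i j * indicator (S i j) \<omega>) \<partial>M)"
  proof (rule Bochner_Integration.integral_cong[OF refl])
    fix \<omega> assume "\<omega> \<in> space M"
    with YZ[OF this] show "f (Y \<omega>) (Z \<omega>) = (\<Sum>i\<in>{0, 1}. \<Sum>j\<in>{0, 1}. f i j * indicator (S i j) \<omega>)"
      by (auto simp: indicator_def S_def simp del: sum_mult_indicator)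
  qed
  also have "\<dots> = (\<Sum>i\<in>{0, 1}. \<Sum>j\<in>{0, 1}. \<integral>\<omega>. f i j * indicator (S i j) \<omega> \<partial>M)"
    using int by (simp del: sum_mult_indicator integral_mult_right_zero)
  also have "\<dots> = (\<Sum>i\<in>{0, 1}. \<Sum>j\<in>{0, 1}. f i j * prob (S i j))"
    using S by (intro sum.cong refl) (auto simp: Int_absorb2 sets.sets_into_space)
  finally show ?thesis unfolding S_def .
qed

lemma (in prob_space) prob_binary_split:
  fixes Z :: "'a \<Rightarrow> nat"
  assumes Z: "Z \<in> measurable M (count_space {0, 1})" and B: "{\<omega> \<in> space M. Q \<omega>} \<in> sets M"
  shows "prob {\<omega> \<in> space M. Z \<omega> = 0 \<and> Q \<omega>} + prob {\<omega> \<in> space M. Z \<omega> = 1 \<and> Q \<omega>} =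
    prob {\<omega> \<in> space M. Q \<omega>}"
proof -
  have ev: "{\<omega> \<in> space M. Z \<omega> = j \<and> Q \<omega>} \<in> sets M" if "j \<in> {0, 1}" for j
  proof -
    have "{\<omega> \<in> space M. Z \<omega> = j \<and> Q \<omega>} = (Z -` {j} \<inter> space M) \<inter> {\<omega> \<in> space M. Q \<omega>}" by auto
    then show ?thesis using that measurable_sets[OF Z, of "{j}"] B by auto
  qed
  have "{\<omega> \<in> space M. Q \<omega>} = {\<omega> \<in> space M. Z \<omega> = 0 \<and> Q \<omega>} \<union> {\<omega> \<in> space M. Z \<omega> = 1 \<and> Q \<omega>}"
    using measurable_space[OF Z] by auto
  moreover have "{\<omega> \<in> space M. Z \<omega> = 0 \<and> Q \<omega>} \<inter> {\<omega> \<in> space M. Z \<omega> = 1 \<and> Q \<omega>} = {}" by auto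
  ultimately show ?thesis
    using finite_measure_Union[OF ev[of 0] ev[of 1]] by simp
qed

locale chain = switching_probs +
  fixes M :: "'a measure" and X :: "nat \<Rightarrow> 'a \<Rightarrow> nat"
  assumes chain: "stationary_binary_chain M X p q"

sublocale chain \<subseteq> prob_space M
  using chain by (simp add: stationary_binary_chain_def)

context chain
begin

lemma X_measurable: "n \<ge> 1 \<Longrightarrow> X n \<in> measurable M (count_space {0, 1})"
  using chain by (simp add: stationary_binary_chain_def)

lemma X_event: "n \<ge> 1 \<Longrightarrow> j \<in> {0, 1} \<Longrightarrow> {\<omega> \<in> space M. X n \<omega> = j} \<in> sets M"
  using measurable_sets[OF X_measurable, of n "{j}"] by (simp add: vimage_def Int_def conj_commute)

lemma joint_law:
  assumes "n \<ge> 1"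
    and m: "prob {\<omega> \<in> space M. X n \<omega> = 0} = q / (p + q)" "prob {\<omega> \<in> space M. X n \<omega> = 1} = p / (p + q)"
  shows "prob {\<omega> \<in> space M. X (Suc n) \<omega> = 1 \<and> X n \<omega> = 0} = q / (p + q) * p"
    and "prob {\<omega> \<in> space M. X (Suc n) \<omega> = 0 \<and> X n \<omega> = 0} = q / (p + q) * (1 - p)"
    and "prob {\<omega> \<in> space M. X (Suc n) \<omega> = 0 \<and> X n \<omega> = 1} = p / (p + q) * q"
    and "prob {\<omega> \<in> space M. X (Suc n) \<omega> = 1 \<and> X n \<omega> = 1} = p / (p + q) * (1 - q)"
proof -
  have "\<P>(\<omega> in M. X (Suc n) \<omega> = 1 \<bar> X n \<omega> = 0) = p" "\<P>(\<omega> in M. X (Suc n) \<omega> = 0 \<bar> X n \<omega> = 1) = q"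
    using chain assms(1) unfolding stationary_binary_chain_def by blast+
  \<comment> \<open>The marginals in \<open>m\<close> are positive, so the conditional probabilities
    are genuine quotients and not the default 0.\<close>
  then show 1: "prob {\<omega> \<in> space M. X (Suc n) \<omega> = 1 \<and> X n \<omega> = 0} = q / (p + q) * p"
    and 2: "prob {\<omega> \<in> space M. X (Suc n) \<omega> = 0 \<and> X n \<omega> = 1} = p / (p + q) * q"
    using p q unfolding cond_prob_def m by (simp_all add: divide_simps mult_ac split: if_splits)
  show "prob {\<omega> \<in> space M. X (Suc n) \<omega> = 0 \<and> X n \<omega> = 0} = q / (p + q) * (1 - p)"
    using prob_binary_split[OF X_measurable[of "Suc n"] X_event[OF assms(1), of 0]] 1 m
    by (simp add: algebra_simps diff_divide_distrib)
  show "prob {\<omega> \<in> space M. X (Suc n) \<omega> = 1 \<and> X n \<omega> = 1} = p / (p + q) * (1 - q)"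
    using prob_binary_split[OF X_measurable[of "Suc n"] X_event[OF assms(1), of 1]] 2 m
    by (simp add: algebra_simps diff_divide_distrib)
qed

text \<open>The law \<open>(q, p) / (p + q)\<close> is a fixed point of one step of the
  chain.\<close>

lemma marginal_law:
  assumes "n \<ge> 1"
  shows "prob {\<omega> \<in> space M. X n \<omega> = 0} = q / (p + q) \<and> prob {\<omega> \<in> space M. X n \<omega> = 1} = p / (p + q)"
  using assms
proof (induction n rule: dec_induct)
  case base
  then show ?case using chain by (simp add: stationary_binary_chain_def)
next
  case (step n)
  have "prob {\<omega> \<in> space M. X (Suc n) \<omega> = j} =
      prob {\<omega> \<in> space M. X (Suc n) \<omega> = j \<and> X n \<omega> = 0} + prob {\<omega> \<in> space M. X (Suc n) \<omega> = j \<and> X n \<omega> = 1}"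
    if "j \<in> {0, 1}" for j
    using prob_binary_split[OF X_measurable[OF step(1)] X_event[of "Suc n", OF _ that]] 
    by (simp add: conj_commute)
  moreover have "q / (p + q) * (1 - p) + p / (p + q) * q = q / (p + q)"
    "q / (p + q) * p + p / (p + q) * (1 - q) = p / (p + q)"
    by (simp_all add: algebra_simps diff_divide_distrib)
  ultimately show ?case
    using step joint_law[of n] by (simp del: One_nat_def)
qed

text \<open>By stationarity all \<open>N\<close> summands agree. The logit after 0 is
  \<open>b - e\<^sup>2 / 2\<close>; after 1 it is larger by the logit jump.\<close>

lemma loss_bias_eq:
  assumes "N \<ge> 1"
  shows "loss_bias M X N (e, w) b = F (e\<^sup>2 * gain w) (b - e\<^sup>2 / 2)"
proof -
  have "(\<integral>\<omega>. log_loss ((2 * real (X (n + 1) \<omega>) - 1) *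
         (e\<^sup>2 * (1 + 2 * w * \<bar>w\<bar>) * real (X n \<omega>) + b - e\<^sup>2 / 2)) \<partial>M) = F (e\<^sup>2 * gain w) (b - e\<^sup>2 / 2)"
    if n: "n \<ge> 1" for n
  proof -
    note law = joint_law[OF n conjunct1[OF marginal_law[OF n]] conjunct2[OF marginal_law[OF n]]]
    show ?thesis
      by (rule trans[OF integral_two_binary[OF X_measurable[OF n] X_measurable[of "n + 1"],
          of "\<lambda>i j. log_loss ((2 * real j - 1) * (e\<^sup>2 * (1 + 2 * w * \<bar>w\<bar>) * real i + b - e\<^sup>2 / 2))"]])
        (simp_all add: law[simplified] F_def cross_entropy_def gain_def algebra_simps add_divide_distrib diff_divide_distrib)
  qed
  then show ?thesis using assms by (simp add: loss_bias_def del: One_nat_def)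
qed

lemma loss_eq:
  assumes "N \<ge> 1"
  shows "loss M X N = L"
proof
  fix \<theta> :: "real \<times> real"
  obtain e w where \<theta>: "\<theta> = (e, w)" by (cases \<theta>)
  let ?b = "opt (e\<^sup>2 * gain w) + e\<^sup>2 / 2"
  have min: "loss_bias M X N \<theta> ?b \<le> loss_bias M X N \<theta> b" for b
    unfolding \<theta> loss_bias_eq[OF assms] using F_min by simp
  then have "is_arg_min (loss_bias M X N \<theta>) (\<lambda>_. True) ?b" by (auto simp: is_arg_min_linorder)
  \<comment> \<open>\<open>arg_min\<close> chooses some minimiser; as \<open>?b\<close> is one too,
    the two values can be compared in both directions.\<close>
  then have "is_arg_min (loss_bias M X N \<theta>) (\<lambda>_. True) (best_bias M X N \<theta>)"
    unfolding best_bias_def arg_min_def by (rule someI)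
  then have "loss M X N \<theta> \<le> loss_bias M X N \<theta> ?b" by (simp add: loss_def is_arg_min_linorder)
  then have "loss M X N \<theta> = loss_bias M X N \<theta> ?b" using min[of "best_bias M X N \<theta>"] by (simp add: loss_def)
  also have "\<dots> = L \<theta>" unfolding \<theta> loss_bias_eq[OF assms] by (simp add: L_def \<phi>_def logit_jump_def)
  finally show "loss M X N \<theta> = L \<theta>" .
qed

end

section \<open>Random initialization\<close>

lemma sets_gaussian_init: "sets (gaussian_init \<sigma>) = sets (borel \<Otimes>\<^sub>M borel)"
  unfolding gaussian_init_def by (intro sets_pair_measure_cong) simp_all

lemma normal_tail_bound:
  assumes "0 < \<sigma>" "0 < r"
  shows "measure (density lborel (normal_density 0 \<sigma>)) {x. r \<le> \<bar>x\<bar>} \<le> \<sigma>\<^sup>2 / r\<^sup>2"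
proof -
  let ?N = "density lborel (\<lambda>x. ennreal (normal_density 0 \<sigma> x))"
  interpret N: prob_space ?N by (rule prob_space_normal_density[OF assms(1)])
  have "distr ?N lborel (\<lambda>x. x) = distr ?N ?N (\<lambda>x. x)" by (rule distr_cong) simp_all
  then have D: "distributed ?N lborel (\<lambda>x. x) (normal_density 0 \<sigma>)"
    by (auto simp: distributed_def distr_id)
  have "integrable ?N (\<lambda>x. x ^ 2)"
    using integrable_normal_moment[OF assms(1), of 0 2] by (subst integrable_density) auto
  then show ?thesis
    using N.Chebyshev_inequality[of "\<lambda>x. x" r] assms
      N.normal_distributed_expectation[OF assms(1) D] N.normal_distributed_variance[OF assms(1) D]
    by simp
qed

text \<open>Chebyshev's inequality bounds each tail. The line \<open>e = 0\<close>, which consists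
  of equilibria, is a null set, so removing it leaves the probability unchanged.\<close>

lemma gaussian_init_box:
  assumes "0 < \<sigma>" "0 < r"
  shows "1 - 2 * \<sigma>\<^sup>2 / r\<^sup>2 \<le> measure (gaussian_init \<sigma>) ({e. e \<noteq> 0 \<and> \<bar>e\<bar> < r} \<times> {w. \<bar>w\<bar> < r})"
proof -
  let ?N = "density lborel (\<lambda>x. ennreal (normal_density 0 \<sigma> x))"
  interpret N: prob_space ?N by (rule prob_space_normal_density[OF assms(1)])
  define E W where "E = {e::real. e \<noteq> 0 \<and> \<bar>e\<bar> < r}" and "W = {w::real. \<bar>w\<bar> < r}"
  define d where "d = \<sigma>\<^sup>2 / r\<^sup>2"
  have sets: "E \<in> sets ?N" "W \<in> sets ?N" by (simp_all add: E_def W_def)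
  have "W = space ?N - {x. r \<le> \<bar>x\<bar>}" by (auto simp: W_def)
  then have W: "1 - d \<le> N.prob W"
    using N.prob_compl[of "{x. r \<le> \<bar>x\<bar>}"] normal_tail_bound[OF assms] by (simp add: d_def)
  have "{0::real} \<in> null_sets lborel" by (rule countable_imp_null_set_lborel) simp
  then have "{0} \<in> null_sets ?N"
    using absolutely_continuousI_density[of "\<lambda>x. ennreal (normal_density 0 \<sigma> x)" lborel]
    unfolding absolutely_continuous_def by auto
  then have "N.prob (W - {0}) = N.prob W" using sets(2) by (intro measure_Diff_null_set)
  moreover have "W - {0} = E" by (auto simp: E_def W_def)
  ultimately have E: "1 - d \<le> N.prob E" using W by simp
  have "emeasure (gaussian_init \<sigma>) (E \<times> W) = emeasure ?N E * emeasure ?N W"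
    unfolding gaussian_init_def by (rule N.emeasure_pair_measure_Times[OF sets])
  then have prod: "measure (gaussian_init \<sigma>) (E \<times> W) = N.prob E * N.prob W"
    by (simp add: measure_def enn2real_mult)
  have "1 - 2 * d \<le> N.prob E * N.prob W"
  proof -
    \<comment> \<open>Expanded, this bounds the product below by the sum of the two probabilities
      minus 1.\<close>
    have "0 \<le> (1 - N.prob E) * (1 - N.prob W)" by simp
    then show ?thesis using E W by (simp add: algebra_simps)
  qed
  then show ?thesis unfolding prod[symmetric] by (simp add: d_def E_def W_def)
qed

lemma gaussian_init_box_eventually:
  assumes "0 < \<epsilon>" "0 < r"
  shows "\<forall>\<^sub>F \<sigma> in at_right 0.
    1 - \<epsilon> \<le> measure (gaussian_init \<sigma>) ({e. e \<noteq> 0 \<and> \<bar>e\<bar> < r} \<times> {w. \<bar>w\<bar> < r})"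
proof -
  have "((\<lambda>\<sigma>::real. 2 * \<sigma>\<^sup>2 / r\<^sup>2) \<longlongrightarrow> 2 * 0\<^sup>2 / r\<^sup>2) (at_right 0)"
    using assms(2) by (intro tendsto_intros) auto
  then have "\<forall>\<^sub>F \<sigma> in at_right 0. 2 * \<sigma>\<^sup>2 / r\<^sup>2 < \<epsilon>"
    using assms(1) by (intro order_tendstoD(2)) auto
  then show ?thesis
    using eventually_at_right_less[of 0]
  proof eventually_elim
    case (elim \<sigma>)
    then show ?case using gaussian_init_box[of \<sigma> r] assms(2) by linarith
  qed
qed

lemma eighth_less: "1 / 8 < 1 / sqrt 2"
proof -
  have "sqrt 2 < sqrt (8\<^sup>2)" unfolding real_sqrt_less_iff by simp
  then show ?thesis by (simp add: divide_simps)
qed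

text \<open>Near the origin \<open>ln (- w)\<close> is so negative that the conserved quantity is
  below \<open>E_sad\<close>. The size 1/8 makes its bound \<open>1 / 64 - 3 * ln 2\<close>, which
  the estimate \<open>ln 2 \<ge> 2 / 3\<close> can compare with \<open>E_sad\<close>.\<close>

lemma small_box_subset_I_min:
  "{e. e \<noteq> 0 \<and> \<bar>e\<bar> < 1 / 8} \<times> {w. \<bar>w\<bar> < 1 / 8} \<subseteq> I_min"
proof
  fix y :: "real \<times> real" assume "y \<in> {e. e \<noteq> 0 \<and> \<bar>e\<bar> < 1 / 8} \<times> {w. \<bar>w\<bar> < 1 / 8}"
  then obtain e w where y: "y = (e, w)" "\<bar>e\<bar> < 1 / 8" "\<bar>w\<bar> < 1 / 8" by auto
  show "y \<in> I_min"
  proof (cases "0 \<le> w")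
    case False
    then have w: "w < 0" "- w < 1 / 8" using y by auto
    have "ln (- w) < ln (1 / 8)" using w by simp
    also have "ln (1 / 8 :: real) = - (3 * ln 2)"
      using ln_realpow[of 2 3] by (simp add: ln_div)
    finally have "ln (- w) < - (3 * ln 2)" .
    moreover have "\<bar>e\<bar>\<^sup>2 < (1 / 8)\<^sup>2" using y(2) by (intro power_strict_mono) auto
    then have "e\<^sup>2 < 1 / 64" by (simp add: power_divide)
    ultimately have "e\<^sup>2 - w\<^sup>2 + ln (- w) < 1 / 64 - 3 * ln 2"
      using zero_le_power2[of w] by linarith
    also have "\<dots> < E_sad"
      using ln2_ge_two_thirds by (simp add: E_sad_def field_simps)
    finally have "e\<^sup>2 - w\<^sup>2 + ln (- w) < E_sad" .
    then have "\<bar>e\<bar> < g w" using abs_less_g_iff(1)[OF w(1)] by blast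
    moreover have "- (1 / sqrt 2) < w" using eighth_less w by linarith
    ultimately show ?thesis using w y(1) by (auto simp: I_min_def)
  qed (simp add: y I_min_def)
qed

lemma small_box_measurable:
  "{e. e \<noteq> 0 \<and> \<bar>e\<bar> < r} \<times> {w. \<bar>w\<bar> < r} \<in> sets (gaussian_init \<sigma>)"
  unfolding sets_gaussian_init by (rule pair_measureI) simp_all

theorem theorem2:
  shows
    "(\<forall>(p::real) (q::real) (N::nat) (M::'a measure) X \<theta>\<^sub>0 \<theta>.
        0 < p \<and> p < 1 \<and> 0 < q \<and> q < 1 \<and> p + q > 1 \<and> N \<ge> 1 \<and>
        stationary_binary_chain M X p q \<and>
        gradient_flow (loss M X N) \<theta> \<and> \<theta> 0 = \<theta>\<^sub>0 \<longrightarrow>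
        (\<exists>\<theta>lim. (\<theta> \<longlongrightarrow> \<theta>lim) at_top \<and>
           critical_point (loss M X N) \<theta>lim \<and>
           (\<theta>\<^sub>0 \<in> I_min \<longrightarrow> local_minimum (loss M X N) \<theta>lim) \<and>
           (\<theta>\<^sub>0 \<in> I_sad \<longrightarrow> saddle_point (loss M X N) \<theta>lim) \<and>
           (\<theta>\<^sub>0 \<in> I_max \<longrightarrow> local_maximum (loss M X N) \<theta>lim) \<and>
           (\<theta>\<^sub>0 \<in> I_star \<longrightarrow> global_minimum (loss M X N) \<theta>lim)))
     \<and>
     (\<forall>\<epsilon>>0. \<forall>\<^sub>F \<sigma> in at_right 0.
        \<forall>(p::real) (q::real) (N::nat) (M::'a measure) X.
          0 < p \<and> p < 1 \<and> 0 < q \<and> q < 1 \<and> p + q > 1 \<and> N \<ge> 1 \<and>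
          stationary_binary_chain M X p q \<longrightarrow>
          holds_with_prob_ge (gaussian_init \<sigma>) (1 - \<epsilon>)
            (\<lambda>\<theta>\<^sub>0. flow_limit_satisfies (loss M X N) \<theta>\<^sub>0
              (\<lambda>\<theta>lim. local_minimum (loss M X N) \<theta>lim \<and> \<not> global_minimum (loss M X N) \<theta>lim)))
     \<and>
     (\<forall>\<epsilon>>0. \<forall>\<^sub>F \<sigma> in at_right 0.
        \<forall>(p::real) (q::real) (N::nat) (M::'a measure) X.
          0 < p \<and> p < 1 \<and> 0 < q \<and> q < 1 \<and> p + q < 1 \<and> N \<ge> 1 \<and>
          stationary_binary_chain M X p q \<longrightarrow>
          holds_with_prob_ge (gaussian_init \<sigma>) (1 - \<epsilon>)
            (\<lambda>\<theta>\<^sub>0. flow_limit_satisfies (loss M X N) \<theta>\<^sub>0 (global_minimum (loss M X N))))"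
proof (intro conjI allI impI)
  let ?B = "{e::real. e \<noteq> 0 \<and> \<bar>e\<bar> < 1 / 8} \<times> {w::real. \<bar>w\<bar> < 1 / 8}"
  have limit: "\<exists>\<theta>lim. (\<theta> \<longlongrightarrow> \<theta>lim) at_top \<and> critical_point (loss M X N) \<theta>lim \<and>
      (\<theta> 0 \<in> I_min \<longrightarrow> local_minimum (loss M X N) \<theta>lim \<and> \<not> global_minimum (loss M X N) \<theta>lim) \<and>
      (\<theta> 0 \<in> I_sad \<longrightarrow> saddle_point (loss M X N) \<theta>lim) \<and>
      (\<theta> 0 \<in> I_max \<longrightarrow> local_maximum (loss M X N) \<theta>lim) \<and>
      (\<theta> 0 \<in> I_star \<longrightarrow> global_minimum (loss M X N) \<theta>lim)"
    if H: "0 < p \<and> p < 1 \<and> 0 < q \<and> q < 1 \<and> p + q > 1 \<and> N \<ge> 1 \<and> stationary_binary_chain M X p q"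
      and flow: "gradient_flow (loss M X N) \<theta>"
    for p q :: real and N :: nat and M :: "'a measure" and X \<theta>
  proof -
    interpret chain p q M X by unfold_locales (use H in auto)
    have loss: "loss M X N = L" by (rule loss_eq) (use H in simp)
    have "a < 0" using H a_neg_iff by simp
    from flow_limit_bistable[OF this flow[unfolded loss]] show ?thesis unfolding loss .
  qed
  {
    fix p q :: real and N :: nat and M :: "'a measure" and X \<theta>\<^sub>0 \<theta>
    assume "0 < p \<and> p < 1 \<and> 0 < q \<and> q < 1 \<and> p + q > 1 \<and> N \<ge> 1 \<and>
      stationary_binary_chain M X p q \<and> gradient_flow (loss M X N) \<theta> \<and> \<theta> 0 = \<theta>\<^sub>0"
    then show "\<exists>\<theta>lim. (\<theta> \<longlongrightarrow> \<theta>lim) at_top \<and>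
           critical_point (loss M X N) \<theta>lim \<and>
           (\<theta>\<^sub>0 \<in> I_min \<longrightarrow> local_minimum (loss M X N) \<theta>lim) \<and>
           (\<theta>\<^sub>0 \<in> I_sad \<longrightarrow> saddle_point (loss M X N) \<theta>lim) \<and>
           (\<theta>\<^sub>0 \<in> I_max \<longrightarrow> local_maximum (loss M X N) \<theta>lim) \<and>
           (\<theta>\<^sub>0 \<in> I_star \<longrightarrow> global_minimum (loss M X N) \<theta>lim)"
      using limit[of p q N M X \<theta>] by blast
  }
  fix \<epsilon> :: real assume "0 < \<epsilon>"
  \<comment> \<open>One box independent of \<open>p\<close>, \<open>q\<close>, \<open>N\<close> and
    the chain serves both regimes, so the threshold on \<open>\<sigma>\<close> is uniform in
    them.\<close>
  then have ev: "\<forall>\<^sub>F \<sigma> in at_right 0. 1 - \<epsilon> \<le> measure (gaussian_init \<sigma>) ?B"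
    by (intro gaussian_init_box_eventually) simp_all
  show "\<forall>\<^sub>F \<sigma> in at_right 0.
        \<forall>(p::real) (q::real) (N::nat) (M::'a measure) X.
          0 < p \<and> p < 1 \<and> 0 < q \<and> q < 1 \<and> p + q > 1 \<and> N \<ge> 1 \<and>
          stationary_binary_chain M X p q \<longrightarrow>
          holds_with_prob_ge (gaussian_init \<sigma>) (1 - \<epsilon>)
            (\<lambda>\<theta>\<^sub>0. flow_limit_satisfies (loss M X N) \<theta>\<^sub>0
              (\<lambda>\<theta>lim. local_minimum (loss M X N) \<theta>lim \<and> \<not> global_minimum (loss M X N) \<theta>lim))"
    using ev
  proof (rule eventually_mono, intro allI impI)
    fix \<sigma> p q :: real and N :: nat and M :: "'a measure" and X
    assume B: "1 - \<epsilon> \<le> measure (gaussian_init \<sigma>) ?B"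
      and H: "0 < p \<and> p < 1 \<and> 0 < q \<and> q < 1 \<and> p + q > 1 \<and> N \<ge> 1 \<and> stationary_binary_chain M X p q"
    show "holds_with_prob_ge (gaussian_init \<sigma>) (1 - \<epsilon>)
            (\<lambda>\<theta>\<^sub>0. flow_limit_satisfies (loss M X N) \<theta>\<^sub>0
              (\<lambda>\<theta>lim. local_minimum (loss M X N) \<theta>lim \<and> \<not> global_minimum (loss M X N) \<theta>lim))"
      unfolding holds_with_prob_ge_def flow_limit_satisfies_def
    proof (intro bexI[of _ ?B] conjI ballI allI impI B small_box_measurable)
      fix \<theta>\<^sub>0 \<theta> assume "\<theta>\<^sub>0 \<in> ?B" and flow: "gradient_flow (loss M X N) \<theta> \<and> \<theta> 0 = \<theta>\<^sub>0"
      then have "\<theta> 0 \<in> I_min" using small_box_subset_I_min by auto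
      then show "\<exists>\<theta>lim. (\<theta> \<longlongrightarrow> \<theta>lim) at_top \<and>
          local_minimum (loss M X N) \<theta>lim \<and> \<not> global_minimum (loss M X N) \<theta>lim"
        using limit[OF H conjunct1[OF flow]] by auto
    qed
  qed
  show "\<forall>\<^sub>F \<sigma> in at_right 0.
        \<forall>(p::real) (q::real) (N::nat) (M::'a measure) X.
          0 < p \<and> p < 1 \<and> 0 < q \<and> q < 1 \<and> p + q < 1 \<and> N \<ge> 1 \<and>
          stationary_binary_chain M X p q \<longrightarrow>
          holds_with_prob_ge (gaussian_init \<sigma>) (1 - \<epsilon>)
            (\<lambda>\<theta>\<^sub>0. flow_limit_satisfies (loss M X N) \<theta>\<^sub>0 (global_minimum (loss M X N)))"
    using ev
  proof (rule eventually_mono, intro allI impI)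
    fix \<sigma> p q :: real and N :: nat and M :: "'a measure" and X
    assume B: "1 - \<epsilon> \<le> measure (gaussian_init \<sigma>) ?B"
      and H: "0 < p \<and> p < 1 \<and> 0 < q \<and> q < 1 \<and> p + q < 1 \<and> N \<ge> 1 \<and> stationary_binary_chain M X p q"
    interpret chain p q M X by unfold_locales (use H in auto)
    have loss: "loss M X N = L" by (rule loss_eq) (use H in simp)
    have "0 < a" using H a_pos_iff by simp
    show "holds_with_prob_ge (gaussian_init \<sigma>) (1 - \<epsilon>)
            (\<lambda>\<theta>\<^sub>0. flow_limit_satisfies (loss M X N) \<theta>\<^sub>0 (global_minimum (loss M X N)))"
      unfolding holds_with_prob_ge_def flow_limit_satisfies_def loss
    proof (intro bexI[of _ ?B] conjI ballI allI impI B small_box_measurable)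
      fix \<theta>\<^sub>0 \<theta> assume \<theta>: "\<theta>\<^sub>0 \<in> ?B" "gradient_flow L \<theta> \<and> \<theta> 0 = \<theta>\<^sub>0"
      show "\<exists>\<theta>lim. (\<theta> \<longlongrightarrow> \<theta>lim) at_top \<and> global_minimum L \<theta>lim"
      proof (rule flow_limit_global[OF \<open>0 < a\<close>])
        show "gradient_flow L \<theta>" "fst (\<theta> 0) \<noteq> 0" using \<theta> by auto
        have "- (1 / 8) < snd (\<theta> 0)" using \<theta> by auto
        then show "- (1 / sqrt 2) < snd (\<theta> 0)" using eighth_less by linarith
      qed
    qed
  qed
qed

end
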